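(* Fix any $t_0\in\mathbb{R}$ and any Borel probability measure $\mu$ in $\mathbb{R}^n$, and define a family of Borel probability measures $(\mu_t)_{t\in\mathbb{R}}$ by their Fourier transforms, $$\widehat{\mu}_t(h):=\widehat{\mu}(U^*(t,t_0)h),\quad t\in\mathbb{R},\ h\in\mathbb{R}^n.$$ Then the measures $$\nu_t=\mathcal{N}_{g(t,-\infty),Q(t,-\infty)}\star\mu_t,\quad t\in\mathbb{R},$$ are an evolution system of measures for $P_{s,t}$. Moreover, all the evolution systems of measures for $P_{s,t}$ are of this type.
   Context: Standing assumptions. $A,B:\mathbb{R}\to\mathcal{L}(\mathbb{R}^n)$ and $f:\mathbb{R}\to\mathbb{R}^n$ are continuous and bounded. There is $\mu_0>0$ with $\|B(t)x\|\ge\mu_0\|x\|$ for all $t\in\mathbb{R}$, $x\in\mathbb{R}^n$. $U(t,s)$ ($t,s\in\mathbb{R}$) is the evolution family generated by $A(\cdot)$, i.e. $\partial_tU(t,s)=A(t)U(t,s)$, $U(s,s)=I$, and its growth bound $\omega_0(U):=\inf\{\omega\in\mathbb{R}:\exists M=M(\omega)\text{ such that }\|U(t,s)\|\le Me^{\omega(t-s)},\ -\infty<s\le t<\infty\}$ satisfies $\omega_0(U)<0$. Notation. For $-\infty\le s<t$ put $g(t,s)=\int_s^tU(t,r)f(r)\,dr$ and $Q(t,s)=\int_s^tU(t,r)B(r)B^*(r)U^*(t,r)\,dr$. $\mathcal{N}_{m,Q}$ is the Gaussian measure on $\mathbb{R}^n$ with mean $m$ and covariance $Q$. $\star$ denotes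 convolution of measures and $\widehat{\mu}(h)=\int_{\mathbb{R}^n}e^{i\langle x,h\rangle}\mu(dx)$. For $-\infty<s\le t<\infty$, $P_{s,t}\varphi(x)=\int_{\mathbb{R}^n}\varphi(y+g(t,s))\,\mathcal{N}_{U(t,s)x,Q(t,s)}(dy)$, $\varphi\in C_b(\mathbb{R}^n)$. An evolution system of measures for $P_{s,t}$ is a family of Borel probability measures $(\nu_t)_{t\in\mathbb{R}}$ in $\mathbb{R}^n$ such that $\int_{\mathbb{R}^n}P_{s,t}\varphi(x)\,\nu_s(dx)=\int_{\mathbb{R}^n}\varphi(x)\,\nu_t(dx)$ for all $\varphi\in C_b(\mathbb{R}^n)$ and $s\le t$. *)

theory Defs
  imports "HOL-Probability.Probability"
begin

text \<open>
  Linear operators on \<open>\<real>\<^sup>n\<close> are the matrices of type \<^typ>\<open>real^'n^'n\<close>; the adjoint is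
  \<^const>\<open>transpose\<close> and the operator norm of \<open>M\<close> is \<open>onorm ((*v) M)\<close> (the type-class norm of
  a matrix is the Frobenius norm).
\<close>

definition evolution_family ::
    "(real \<Rightarrow> real^'n^'n) \<Rightarrow> (real \<Rightarrow> real \<Rightarrow> real^'n^'n) \<Rightarrow> bool" where
  "evolution_family A U \<longleftrightarrow>
     (\<forall>t s. ((\<lambda>\<tau>. U \<tau> s) has_vector_derivative (A t ** U t s)) (at t)) \<and>
     (\<forall>s. U s s = mat 1)"

text \<open>The infimum is taken in the extended reals, so that it is meaningful for every \<open>U\<close>.\<close>

definition growth_bound :: "(real \<Rightarrow> real \<Rightarrow> real^'n^'n) \<Rightarrow> ereal" where
  "growth_bound U =
     Inf (ereal ` {\<omega>. \<exists>M. \<forall>s t. s \<le> t \<longrightarrow> onorm ((*v) (U t s)) \<le> M * exp (\<omega> * (t - s))})"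

text \<open>The lower limit \<open>s\<close> is an extended real, so that \<open>s = -\<infinity>\<close> is allowed.\<close>

definition drift_int ::
    "(real \<Rightarrow> real \<Rightarrow> real^'n^'n) \<Rightarrow> (real \<Rightarrow> real^'n) \<Rightarrow> real \<Rightarrow> ereal \<Rightarrow> real^'n" where
  "drift_int U f t s = (LBINT r=s..ereal t. U t r *v f r)"

definition cov_int ::
    "(real \<Rightarrow> real \<Rightarrow> real^'n^'n) \<Rightarrow> (real \<Rightarrow> real^'n^'n) \<Rightarrow> real \<Rightarrow> ereal \<Rightarrow> real^'n^'n" where
  "cov_int U B t s =
     (LBINT r=s..ereal t. U t r ** B r ** transpose (B r) ** transpose (U t r))"

definition borel_prob :: "'a::topological_space measure \<Rightarrow> bool" where
  "borel_prob M \<longleftrightarrow> sets M = sets borel \<and> prob_space M"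

definition fourier :: "(real^'n) measure \<Rightarrow> real^'n \<Rightarrow> complex" where
  "fourier M h = (CLINT x|M. iexp (x \<bullet> h))"

text \<open>
  The Gaussian measure with mean \<open>m\<close> and covariance \<open>Q\<close>. Since \<open>Q\<close> may be degenerate (it is \<open>0\<close> for
  \<open>cov_int U B t t\<close>, giving a Dirac measure), the measure is specified by its Fourier transform
  and not by a density. Meaningful only for symmetric positive semidefinite \<open>Q\<close>.
\<close>

definition gaussian :: "real^'n \<Rightarrow> real^'n^'n \<Rightarrow> (real^'n) measure" where
  "gaussian m Q =
     (THE M. borel_prob M \<and>
        (\<forall>h. fourier M h = exp (\<i> * complex_of_real (m \<bullet> h) - complex_of_real ((Q *v h) \<bullet> h / 2))))"

definition transition ::
    "(real \<Rightarrow> real \<Rightarrow> real^'n^'n) \<Rightarrow> (real \<Rightarrow> real^'n^'n) \<Rightarrow> (real \<Rightarrow> real^'n) \<Rightarrow>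
     real \<Rightarrow> real \<Rightarrow> (real^'n \<Rightarrow> real) \<Rightarrow> real^'n \<Rightarrow> real" where
  "transition U B f s t \<phi> x =
     (LINT y|gaussian (U t s *v x) (cov_int U B t (ereal s)). \<phi> (y + drift_int U f t (ereal s)))"

definition evolution_system_of_measures ::
    "(real \<Rightarrow> real \<Rightarrow> real^'n^'n) \<Rightarrow> (real \<Rightarrow> real^'n^'n) \<Rightarrow> (real \<Rightarrow> real^'n) \<Rightarrow>
     (real \<Rightarrow> (real^'n) measure) \<Rightarrow> bool" where
  "evolution_system_of_measures U B f \<nu> \<longleftrightarrow>
     (\<forall>t. borel_prob (\<nu> t)) \<and>
     (\<forall>\<phi> s t. continuous_on UNIV \<phi> \<longrightarrow> bounded (range \<phi>) \<longrightarrow> s \<le> t \<longrightarrow>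
        (LINT x|\<nu> s. transition U B f s t \<phi> x) = (LINT x|\<nu> t. \<phi> x))"

definition fourier_family ::
    "(real \<Rightarrow> real \<Rightarrow> real^'n^'n) \<Rightarrow> real \<Rightarrow> (real^'n) measure \<Rightarrow>
     (real \<Rightarrow> (real^'n) measure) \<Rightarrow> bool" where
  "fourier_family U t0 \<mu> m \<longleftrightarrow>
     (\<forall>t. borel_prob (m t) \<and> (\<forall>h. fourier (m t) h = fourier \<mu> (transpose (U t t0) *v h)))"

end

theory Submission
  imports Defs
begin

text \<open>
  Write \<open>U\<^sup>*\<close> for the adjoint and \<open>G t s\<close> for the Fourier transform of the Gaussian measure
  with mean \<open>g(t,s)\<close> and covariance \<open>Q(t,s)\<close>. Since a measure is determined by its Fourier
  transform, \<open>\<nu>\<close> is an evolution system iff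
  \<open>fourier (\<nu> t) h = G t s h * fourier (\<nu> s) (U\<^sup>*(t,s) h)\<close> for all \<open>s \<le> t\<close>. The cocycle identity
  \<open>G t (-\<infinity>) h = G t s h * G s (-\<infinity>) (U\<^sup>*(t,s) h)\<close> makes \<open>N(g(t,-\<infinity>), Q(t,-\<infinity>)) \<star> \<mu>\<^sub>t\<close>
  satisfy this.
  Conversely, if \<open>\<nu>\<close> is an evolution system, the Fourier transforms of the images of \<open>\<nu> s\<close> under
  \<open>U(t0,s)\<close> converge, as \<open>s\<close> tends to \<open>-\<infinity>\<close>, to \<open>fourier (\<nu> t0) / G t0 (-\<infinity>)\<close>, which is
  continuous at \<open>0\<close>, so Levy's continuity theorem provides \<open>\<mu>\<close>. The multivariate continuity
  theorem is reduced to Helly's theorem on the line: measures on \<open>\<real>\<^sup>n\<close> are lifted to \<open>\<real>\<close> through a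
  Borel section of a continuous space-filling curve.
\<close>

section \<open>Fourier transforms of measures on Euclidean space\<close>

lemma borel_prob_distr:
  assumes "borel_prob M" "f \<in> borel_measurable borel"
  shows "borel_prob (distr M borel f)"
proof -
  have "f \<in> borel_measurable M"
    using assms measurable_cong_sets unfolding borel_prob_def by blast
  then show ?thesis
    using assms prob_space.prob_space_distr unfolding borel_prob_def by auto
qed

lemma borel_prob_measurable:
  "borel_prob M \<Longrightarrow> f \<in> measurable M N \<longleftrightarrow> f \<in> measurable borel N"
  unfolding borel_prob_def by (metis measurable_cong_sets)

lemma borel_prob_integrable:
  fixes f :: "'a::topological_space \<Rightarrow> 'b::{banach, second_countable_topology}"
  assumes "borel_prob M" "f \<in> borel_measurable borel" "\<And>x. norm (f x) \<le> c"
  shows "integrable M f"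
proof -
  interpret prob_space M using assms by (simp add: borel_prob_def)
  show ?thesis
    by (rule integrable_const_bound[of _ c]) (use assms in \<open>auto simp: borel_prob_measurable\<close>)
qed

lemma integral_convolution_bounded:
  fixes f :: "real^'n \<Rightarrow> 'b::{banach, second_countable_topology}"
  assumes M: "borel_prob M" and N: "borel_prob N"
    and f[measurable]: "f \<in> borel_measurable borel" and bd: "\<And>x. norm (f x) \<le> c"
  shows "(LINT x|convolution M N. f x) = (LINT y|N. LINT x|M. f (x + y))"
proof -
  interpret M: prob_space M using M by (simp add: borel_prob_def)
  interpret N: prob_space N using N by (simp add: borel_prob_def)
  interpret pair_prob_space M N ..
  have [measurable_cong]: "sets M = sets borel" "sets N = sets borel"
    using M N by (auto simp: borel_prob_def)
  have "(LINT x|convolution M N. f x) = (LINT p|(M \<Otimes>\<^sub>M N). f (fst p + snd p))"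
    unfolding convolution_def by (subst integral_distr) (auto simp: case_prod_beta)
  also have "\<dots> = (LINT y|N. LINT x|M. f (x + y))"
  proof -
    have "integrable (M \<Otimes>\<^sub>M N) (case_prod (\<lambda>x y. f (x + y)))"
      using bd by (intro integrable_const_bound[of _ c]) (auto simp: case_prod_beta)
    from integral_snd[OF this] show ?thesis by (simp add: case_prod_unfold)
  qed
  finally show ?thesis .
qed

lemma borel_prob_convolution:
  fixes M N :: "(real^'n) measure"
  assumes M: "borel_prob M" and N: "borel_prob N"
  shows "borel_prob (convolution M N)"
proof -
  interpret M: prob_space M using M by (simp add: borel_prob_def)
  interpret N: prob_space N using N by (simp add: borel_prob_def)
  interpret pair_prob_space M N ..
  have [measurable_cong]: "sets M = sets borel" "sets N = sets borel"
    using M N by (auto simp: borel_prob_def)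
  show ?thesis unfolding borel_prob_def convolution_def
    by (auto intro!: prob_space_distr)
qed

lemma fourier_distr:
  fixes T :: "real^'m \<Rightarrow> real^'n"
  assumes M: "borel_prob M" and T: "T \<in> borel_measurable borel"
  shows "fourier (distr M borel T) h = (CLINT x|M. iexp (T x \<bullet> h))"
  unfolding fourier_def
  by (subst integral_distr) (use assms in \<open>auto simp: borel_prob_measurable\<close>)

lemma measurable_matrix_vector_mult [measurable]:
  fixes T :: "real^'m^'n"
  shows "(*v) T \<in> borel_measurable borel"
  by (intro borel_measurable_continuous_onI linear_continuous_on matrix_vector_mul_bounded_linear)

lemma fourier_distr_matrix:
  fixes T :: "real^'m^'n"
  assumes M: "borel_prob M"
  shows "fourier (distr M borel ((*v) T)) h = fourier M (transpose T *v h)"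
  unfolding fourier_distr[OF assms measurable_matrix_vector_mult]
  by (simp add: fourier_def dot_lmul_matrix[symmetric] inner_commute)

lemma fourier_distr_translation:
  fixes a :: "real^'n"
  assumes M: "borel_prob M"
  shows "fourier (distr M borel (\<lambda>x. x + a)) h = iexp (a \<bullet> h) * fourier M h"
  by (subst fourier_distr[OF assms])
     (auto simp: fourier_def inner_add_left distrib_left exp_add mult.commute)

lemma fourier_convolution:
  fixes M N :: "(real^'n) measure"
  assumes M: "borel_prob M" and N: "borel_prob N"
  shows "fourier (convolution M N) h = fourier M h * fourier N h"
  unfolding fourier_def
  by (subst integral_convolution_bounded[OF assms, where c = 1])
     (auto simp: inner_add_left distrib_left exp_add)

lemma norm_fourier_le_1: "borel_prob M \<Longrightarrow> norm (fourier M h) \<le> 1"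
proof -
  assume "borel_prob M"
  then interpret prob_space M by (simp add: borel_prob_def)
  have "norm (fourier M h) \<le> (LINT x|M. norm (iexp (x \<bullet> h)))"
    unfolding fourier_def by (rule integral_norm_bound)
  then show ?thesis by (simp del: of_real_mult add: prob_space)
qed

lemma continuous_on_fourier:
  fixes M :: "(real^'n) measure"
  assumes M: "borel_prob M"
  shows "continuous_on UNIV (fourier M)"
proof -
  interpret prob_space M using M by (simp add: borel_prob_def)
  show ?thesis
    unfolding continuous_on_sequentially comp_def fourier_def
  proof safe
    fix X and h :: "real^'n" assume X: "X \<longlonglongrightarrow> h"
    show "(\<lambda>n. CLINT x|M. iexp (x \<bullet> X n)) \<longlonglongrightarrow> (CLINT x|M. iexp (x \<bullet> h))"
      by (rule integral_dominated_convergence[where w="\<lambda>_. 1"])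
         (auto intro!: tendsto_intros X simp: borel_prob_measurable[OF M])
  qed
qed

lemma fourier_0: "borel_prob M \<Longrightarrow> fourier M 0 = 1"
proof -
  assume "borel_prob M"
  then interpret prob_space M by (simp add: borel_prob_def)
  show ?thesis by (simp add: fourier_def prob_space)
qed

section \<open>Measures determined by bounded continuous functions and by Fourier transforms\<close>

lemma borel_prob_eqI:
  fixes M N :: "'a::metric_space measure"
  assumes M: "borel_prob M" and N: "borel_prob N"
    and eq: "\<And>\<phi>::'a \<Rightarrow> real. continuous_on UNIV \<phi> \<Longrightarrow> bounded (range \<phi>) \<Longrightarrow> (LINT x|M. \<phi> x) = (LINT x|N. \<phi> x)"
  shows "M = N"
proof -
  interpret M: prob_space M using M by (simp add: borel_prob_def)
  interpret N: prob_space N using N by (simp add: borel_prob_def)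
  have sets: "sets M = sets borel" "sets N = sets borel" using M N by (auto simp: borel_prob_def)
  have closed_eq: "emeasure M C = emeasure N C" if C: "closed C" for C
  \<comment> \<open>The empty set is treated apart because \<open>infdist x {}\<close> is 0 by
    convention, which would make the functions below constantly 1.\<close>
  proof (cases "C = {}")
    case False
    \<comment> \<open>For positive \<open>k\<close> these are 1 on \<open>C\<close> and vanish at
      distance at least \<open>1 / k\<close>, so they tend to the indicator. Closed sets are stable
      under intersection and generate the Borel sets, so agreement on them suffices.\<close>
    define \<phi> where "\<phi> k x = max 0 (1 - real k * infdist x C)" for k x
    have cont: "continuous_on UNIV (\<phi> k)" for k
      unfolding \<phi>_def by (intro continuous_intros)
    have bd: "norm (\<phi> k x) \<le> 1" for k x
      using infdist_nonneg[of x C] by (auto simp: \<phi>_def)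
    have lim: "(\<lambda>k. \<phi> k x) \<longlonglongrightarrow> indicator C x" for x
    proof (cases "x \<in> C")
      case True then show ?thesis by (simp add: \<phi>_def)
    next
      case False
      then have pos: "infdist x C > 0"
        using C \<open>C \<noteq> {}\<close> by (metis in_closed_iff_infdist_zero infdist_nonneg less_eq_real_def)
      then obtain k0 where k0: "real k0 * infdist x C > 1" using reals_Archimedean3 by blast
      have "eventually (\<lambda>k. \<phi> k x = 0) sequentially"
        using eventually_ge_at_top[of k0]
      proof eventually_elim
        case (elim k)
        then have "real k0 * infdist x C \<le> real k * infdist x C"
          using pos by (intro mult_right_mono) auto
        then show ?case using k0 by (simp add: \<phi>_def)
      qed
      then show ?thesis using False by (simp add: tendsto_eventually)
    qed
    have lim': "(\<lambda>k. LINT x|K. \<phi> k x) \<longlonglongrightarrow> measure K C" if K: "borel_prob K" for K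
    proof -
      interpret K: prob_space K using K by (simp add: borel_prob_def)
      have "sets K = sets borel" using K by (simp add: borel_prob_def)
      then have "C \<in> sets K" "space K = UNIV" using C sets_eq_imp_space_eq[of K borel] by auto
      moreover have "(\<lambda>k. LINT x|K. \<phi> k x) \<longlonglongrightarrow> (LINT x|K. indicator C x)"
        using bd lim \<open>C \<in> sets K\<close> borel_measurable_continuous_onI[OF cont]
        by (intro integral_dominated_convergence[where w="\<lambda>_. 1"])
           (auto simp: borel_prob_measurable[OF K] \<open>sets K = _\<close>)
      ultimately show ?thesis by simp
    qed
    have "(LINT x|M. \<phi> k x) = (LINT x|N. \<phi> k x)" for k
      using bd by (intro eq cont) (auto simp: bounded_iff)
    then have "measure M C = measure N C"
      using lim'[OF M] lim'[OF N] LIMSEQ_unique by auto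
    then show ?thesis by (simp add: M.emeasure_eq_measure N.emeasure_eq_measure)
  qed simp
  show ?thesis
  proof (rule measure_eqI_generator_eq[where E = "Collect closed" and A = "\<lambda>_. UNIV" and \<Omega> = UNIV])
    show "Int_stable (Collect closed :: 'a set set)" by (auto simp: Int_stable_def)
    show "sets M = sigma_sets UNIV (Collect closed)" "sets N = sigma_sets UNIV (Collect closed)"
      using sets by (auto simp: borel_eq_closed)
  qed (use closed_eq in auto)
qed

text \<open>Equality of Fourier transforms is equality of the integrals of characters, which
  linearity extends to this class. Products stay in it because frequencies add, so it contains all
  polynomials in the coordinate sines.\<close>

inductive trig_poly :: "(real^'n \<Rightarrow> complex) \<Rightarrow> bool" where
  exp: "trig_poly (\<lambda>x. c * iexp (x \<bullet> h))"
| add: "trig_poly F \<Longrightarrow> trig_poly G \<Longrightarrow> trig_poly (\<lambda>x. F x + G x)"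

lemma trig_poly_mult:
  assumes "trig_poly F" "trig_poly G"
  shows "trig_poly (\<lambda>x. F x * G x)"
  using assms
proof (induction F)
  case (exp c h)
  then show ?case
  proof (induction G)
    case (exp c' h')
    have "(\<lambda>x. c * iexp (x \<bullet> h) * (c' * iexp (x \<bullet> h'))) = (\<lambda>x. (c * c') * iexp (x \<bullet> (h + h')))"
      by (auto simp: inner_add_right distrib_left exp_add)
    then show ?case by (simp only: trig_poly.exp)
  next
    case (add F G)
    then show ?case by (simp add: distrib_left trig_poly.add)
  qed
next
  case (add F G)
  then show ?case by (simp add: distrib_right trig_poly.add)
qed

lemma trig_poly_const: "trig_poly (\<lambda>x. c)"
  using trig_poly.exp[of c 0] by simp

lemma trig_poly_sum:
  assumes "finite I" "\<And>i. i \<in> I \<Longrightarrow> trig_poly (F i)"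
  shows "trig_poly (\<lambda>x. \<Sum>i\<in>I. F i x)"
  using assms by (induction I rule: finite_induct) (auto simp: trig_poly_const trig_poly.add)

lemma trig_poly_sin: "trig_poly (\<lambda>x. complex_of_real (sin (x \<bullet> h)))"
proof -
  have "complex_of_real (sin (x \<bullet> h)) = (-\<i>/2) * iexp (x \<bullet> h) + (\<i>/2) * iexp (x \<bullet> (-h))" for x
    by (simp add: complex_eq_iff Re_exp Im_exp)
  then show ?thesis by (simp only: trig_poly.intros)
qed

lemma trig_poly_real_polynomial_sin:
  fixes p :: "real^'n \<Rightarrow> real"
  assumes "real_polynomial_function p"
  shows "trig_poly (\<lambda>x. complex_of_real (p (\<chi> i. sin (c * x $ i))))"
  using assms
proof induction
  case (linear l)
  \<comment> \<open>A linear functional is expanded in the standard basis; the sine of a scaled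
    coordinate is the sine of the inner product with \<open>axis i c\<close>.\<close>
  have *: "l y = (\<Sum>i\<in>UNIV. y $ i * l (axis i 1))" for y
    using linear_sum[OF bounded_linear.linear[OF linear], of "\<lambda>i. y $ i *\<^sub>R axis i 1" UNIV]
      basis_expansion[of y] bounded_linear.linear[OF linear]
    by (simp add: scalar_mult_eq_scaleR linear_cmul)
  have "trig_poly (\<lambda>x. complex_of_real (sin (c * x $ i)) * complex_of_real (l (axis i 1)))" for i
    using trig_poly_sin[of "axis i c"]
    by (intro trig_poly_mult trig_poly_const) (simp add: inner_axis mult.commute)
  then show ?case by (subst *) (auto intro!: trig_poly_sum)
qed (auto intro: trig_poly_const trig_poly.add trig_poly_mult)

text \<open>Integrability is carried through the induction together with the equality, since
  additivity of the integral requires it.\<close>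

lemma integral_trig_poly_eq:
  assumes M: "borel_prob M" and N: "borel_prob N" and eq: "\<And>h. fourier M h = fourier N h"
    and F: "trig_poly F"
  shows "(CLINT x|M. F x) = (CLINT x|N. F x)"
proof -
  have int: "integrable K (\<lambda>x. c * iexp (x \<bullet> h))" if "borel_prob K" for K c and h :: "real^'n"
    by (rule borel_prob_integrable[OF that, where c = "norm c"]) (auto simp: norm_mult)
  have "integrable M F \<and> integrable N F \<and> (CLINT x|M. F x) = (CLINT x|N. F x)"
    using F
  proof induction
    case (exp c h)
    then show ?case using eq[of h] int[OF M] int[OF N] by (simp add: fourier_def)
  qed auto
  then show ?thesis by simp
qed

text \<open>Since \<open>L sin(x/L)\<close> tends to \<open>x\<close>, a test function \<open>\<phi>\<close> is a limit of functions \<open>\<phi>(L sin(x/L))\<close>.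
  By Stone--Weierstrass on the cube these are uniform limits, on all of \<open>\<real>\<^sup>n\<close>, of polynomials in the
  sines, and such polynomials are trigonometric.\<close>

theorem fourier_unique:
  fixes M N :: "(real^'n) measure"
  assumes M: "borel_prob M" and N: "borel_prob N" and eq: "\<And>h. fourier M h = fourier N h"
  shows "M = N"
proof (rule borel_prob_eqI[OF M N])
  fix \<phi> :: "real^'n \<Rightarrow> real"
  assume cont: "continuous_on UNIV \<phi>" and bd: "bounded (range \<phi>)"
  obtain b where b: "\<And>x. norm (\<phi> x) \<le> b" using bd by (auto simp: bounded_iff)
  have [measurable]: "\<phi> \<in> borel_measurable borel" by (rule borel_measurable_continuous_onI[OF cont])
  define S where "S L x = (\<chi> i. sin (x $ i / L) :: real^'n)" for L x
  \<comment> \<open>For \<open>L = 0\<close> division by zero gives 0, so \<open>S 0\<close> is the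
    zero map and still continuous.\<close>
  have contS: "continuous_on UNIV (S L)" for L
    unfolding S_def by (cases "L = 0") (auto intro!: continuous_intros)
  have [measurable]: "S L \<in> borel_measurable borel" for L
    by (rule borel_measurable_continuous_onI[OF contS])
  have S_cube: "S L x \<in> cbox (-1) 1" for L x
    by (auto simp: S_def mem_box_cart)
  have int: "integrable K (\<lambda>x. \<phi> (L *\<^sub>R S L x))" if "borel_prob K" for K L
    by (rule borel_prob_integrable[OF that _ b]) measurable
  have step: "(LINT x|M. \<phi> (L *\<^sub>R S L x)) = (LINT x|N. \<phi> (L *\<^sub>R S L x))" for L
  proof (rule ccontr)
    assume ne: "\<not> ?thesis"
    \<comment> \<open>A third of the gap: both integrals will lie within \<open>e\<close> of the
      same number, so the gap \<open>3 * e\<close> would be at most \<open>2 * e\<close>.\<close>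
    define e where "e = \<bar>(LINT x|M. \<phi> (L *\<^sub>R S L x)) - (LINT x|N. \<phi> (L *\<^sub>R S L x))\<bar> / 3"
    have e: "e > 0" using ne by (simp add: e_def)
    have "continuous_on (cbox (-1) 1) (\<lambda>y. \<phi> (L *\<^sub>R y))"
      by (intro continuous_on_compose2[OF cont] continuous_intros) auto
    from Stone_Weierstrass_real_polynomial_function[OF compact_cbox this e]
    obtain p where p: "real_polynomial_function p"
      and pe: "\<And>y. y \<in> cbox (-1) 1 \<Longrightarrow> \<bar>\<phi> (L *\<^sub>R y) - p y\<bar> < e" by blast
    have pcont: "continuous_on UNIV p"
      using p by (simp add: continuous_at_imp_continuous_on continuous_real_polymonial_function)
    have [measurable]: "p \<in> borel_measurable borel"
      by (rule borel_measurable_continuous_onI[OF pcont])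
    \<comment> \<open>Off the cube \<open>p\<close> is uncontrolled; on the cube, where
      \<open>S L\<close> takes its values, it inherits a bound from \<open>\<phi>\<close>.\<close>
    have pb: "norm (p (S L x)) \<le> b + e" for x
      using pe[OF S_cube, of L x] b[of "L *\<^sub>R S L x"] by auto
    have pint: "integrable K (\<lambda>x. p (S L x))" if "borel_prob K" for K
      by (rule borel_prob_integrable[OF that _ pb]) measurable
    have "(CLINT x|M. of_real (p (S L x))) = (CLINT x|N. of_real (p (S L x)))"
      using trig_poly_real_polynomial_sin[OF p, of "1/L"]
      by (intro integral_trig_poly_eq[OF M N eq]) (simp add: S_def)
    then have peq: "(LINT x|M. p (S L x)) = (LINT x|N. p (S L x))" by simp
    have close: "\<bar>(LINT x|K. \<phi> (L *\<^sub>R S L x)) - (LINT x|K. p (S L x))\<bar> \<le> e" if K: "borel_prob K" for K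
    proof -
      interpret K: prob_space K using K by (simp add: borel_prob_def)
      have "\<bar>(LINT x|K. \<phi> (L *\<^sub>R S L x)) - (LINT x|K. p (S L x))\<bar>
          = norm (LINT x|K. \<phi> (L *\<^sub>R S L x) - p (S L x))"
        using int[OF K] pint[OF K] by simp
      also have "\<dots> \<le> (LINT x|K. norm (\<phi> (L *\<^sub>R S L x) - p (S L x)))" by (rule integral_norm_bound)
      also have "\<dots> \<le> (LINT x|K. e)"
        using pe[OF S_cube, of L] int[OF K] pint[OF K]
        by (intro integral_mono) (auto intro: less_imp_le)
      finally show ?thesis by (simp add: K.prob_space)
    qed
    have "\<bar>(LINT x|M. \<phi> (L *\<^sub>R S L x)) - (LINT x|N. \<phi> (L *\<^sub>R S L x))\<bar> \<le> 2 * e"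
      using close[OF M] close[OF N] peq by linarith
    then show False using e by (simp add: e_def)
  qed
  \<comment> \<open>Difference quotients at 0 of \<open>sin (a * x)\<close> along
    \<open>x = 1 / k\<close> tend to the derivative \<open>a\<close>; the shift to
    \<open>Suc k\<close> avoids the scale 0.\<close>
  have lim_sin: "(\<lambda>k. real (Suc k) * sin (a / real (Suc k))) \<longlonglongrightarrow> a" for a :: real
  proof -
    have "((\<lambda>x. sin (a * x)) has_field_derivative a) (at 0)"
      by (auto intro!: derivative_eq_intros)
    then have "((\<lambda>x. sin (a * x) / x) \<longlongrightarrow> a) (at 0)"
      by (simp add: has_field_derivative_iff)
    moreover have "filterlim (\<lambda>k. 1 / real k) (at 0) sequentially"
      by (auto simp: filterlim_at lim_1_over_n intro: eventually_sequentiallyI[of 1])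
    ultimately have "(\<lambda>k. sin (a * (1 / real k)) / (1 / real k)) \<longlonglongrightarrow> a"
      by (rule filterlim_compose)
    then have "(\<lambda>k. real k * sin (a / real k)) \<longlonglongrightarrow> a"
      by (simp add: mult.commute)
    then show ?thesis by (rule LIMSEQ_Suc)
  qed
  have lim: "(\<lambda>k. real (Suc k) *\<^sub>R S (real (Suc k)) x) \<longlonglongrightarrow> x" for x
    by (rule vec_tendstoI) (use lim_sin in \<open>auto simp: S_def\<close>)
  have "(\<lambda>k. \<phi> (real (Suc k) *\<^sub>R S (real (Suc k)) x)) \<longlonglongrightarrow> \<phi> x" for x
    using continuous_on_tendsto_compose[OF cont lim, of x] by auto
  then have lim': "(\<lambda>k. LINT x|K. \<phi> (real (Suc k) *\<^sub>R S (real (Suc k)) x)) \<longlonglongrightarrow> (LINT x|K. \<phi> x)"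
    if K: "borel_prob K" for K
  proof -
    interpret K: prob_space K using K by (simp add: borel_prob_def)
    show ?thesis
      using b \<open>\<And>x. (\<lambda>k. \<phi> _) \<longlonglongrightarrow> \<phi> x\<close>
      by (intro integral_dominated_convergence[where w="\<lambda>_. b"])
         (auto simp: borel_prob_measurable[OF K])
  qed
  show "(LINT x|M. \<phi> x) = (LINT x|N. \<phi> x)"
    using lim'[OF M] lim'[OF N] unfolding step by (rule LIMSEQ_unique)
qed

section \<open>A space-filling curve with a measurable section\<close>

text \<open>The triangular wave of period 2 that equals the absolute value of \<open>t\<close> on
  \<open>[-1, 1]\<close>. The trigonometric form gives continuity and periodicity directly.\<close>

definition tent :: "real \<Rightarrow> real" where "tent t = arccos (cos (pi * t)) / pi"

lemma continuous_on_tent [continuous_intros]: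
  fixes f :: "real \<Rightarrow> real"
  shows "continuous_on A f \<Longrightarrow> continuous_on A (\<lambda>x. tent (f x))"
  unfolding tent_def by (intro continuous_intros) auto

lemma tent_eq: "0 \<le> u \<Longrightarrow> u \<le> 1 \<Longrightarrow> tent (2 * of_int m + u) = u"
proof -
  assume u: "0 \<le> u" "u \<le> 1"
  have "cos (pi * (2 * of_int m + u)) = cos (pi * u + of_int m * (2 * pi))"
    by (simp add: algebra_simps)
  also have "\<dots> = cos (pi * u)"
    using cos_int_2pin[of m] sin_int_2pin[of m] by (simp add: cos_add mult_ac)
  finally show ?thesis using u by (simp add: tent_def arccos_cos)
qed

text \<open>The digit reader of Schoenberg's curve: 0 where the wave is at most 1/3, 1 where it is
  at least 2/3, linear in the wave in between to stay continuous.\<close>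

definition digit_fun :: "real \<Rightarrow> real" where
  "digit_fun t = max 0 (min 1 (3 * tent t - 1))"

lemma digit_fun_bounds: "0 \<le> digit_fun t" "digit_fun t \<le> 1" by (auto simp: digit_fun_def)

lemma continuous_on_digit_fun [continuous_intros]:
  fixes f :: "real \<Rightarrow> real"
  shows "continuous_on A f \<Longrightarrow> continuous_on A (\<lambda>x. digit_fun (f x))"
  unfolding digit_fun_def by (intro continuous_intros)

text \<open>For \<open>c\<close> with values 0 and 1, the point of the Cantor set with ternary
  digits \<open>2 * c j\<close>. Avoiding the digit 1 keeps \<open>digit_fun\<close> off its
  interpolating pieces.\<close>

definition ternary :: "(nat \<Rightarrow> real) \<Rightarrow> real" where
  "ternary c = (\<Sum>j. 2 * c j / 3 ^ Suc j)"

lemma summable_ternary: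
  assumes "\<And>j. c j \<in> {0, 1::real}"
  shows "summable (\<lambda>j. 2 * c j / 3 ^ Suc j)"
proof (rule summable_comparison_test'[where N = 0 and g = "\<lambda>j. 2/3 * (1/3) ^ j"])
  show "norm (2 * c j / 3 ^ Suc j) \<le> 2/3 * (1/3) ^ j" for j
    using assms[of j] by (auto simp: power_divide)
qed (auto intro!: summable_mult summable_geometric)

lemma ternary_bounds:
  assumes "\<And>j. c j \<in> {0, 1::real}"
  shows "0 \<le> ternary c" "ternary c \<le> 1"
proof -
  show "0 \<le> ternary c" unfolding ternary_def
  proof (rule suminf_nonneg[OF summable_ternary[OF assms]])
    show "0 \<le> 2 * c j / 3 ^ Suc j" for j using assms[of j] by auto
  qed
  have "ternary c \<le> (\<Sum>j. 2/3 * (1/3) ^ j)" unfolding ternary_def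
  proof (rule suminf_le[OF _ summable_ternary[OF assms]])
    show "2 * c j / 3 ^ Suc j \<le> 2/3 * (1/3) ^ j" for j using assms[of j] by (auto simp: power_divide)
  qed (auto intro!: summable_mult summable_geometric)
  also have "\<dots> = 1" by (subst suminf_mult) (auto simp: suminf_geometric)
  finally show "ternary c \<le> 1" .
qed

lemma ternary_Suc:
  assumes "\<And>j. c j \<in> {0, 1::real}"
  shows "3 * ternary c = 2 * c 0 + ternary (\<lambda>j. c (Suc j))"
proof -
  have "ternary c = 2 * c 0 / 3 + (\<Sum>j. (1/3) * (2 * c (Suc j) / 3 ^ Suc j))"
    unfolding ternary_def using suminf_split_head[OF summable_ternary[of c, OF assms]] by simp
  also have "(\<Sum>j. (1/3) * (2 * c (Suc j) / 3 ^ Suc j)) = 1/3 * ternary (\<lambda>j. c (Suc j))"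
    unfolding ternary_def by (rule suminf_mult) (intro summable_ternary assms)
  finally show ?thesis by simp
qed

text \<open>Multiplication by \<open>3 ^ m\<close> moves the first \<open>m\<close> digits into the
  integer part. That part is even because the digits are 0 or 2, so a wave of period 2 ignores it
  and digit \<open>m\<close> is read. The arbitrary even integer \<open>2 * of_int i\<close> lets
  the induction absorb the digits moved out.\<close>

lemma digit_fun_ternary:
  assumes c: "\<And>j. c j \<in> {0, 1::real}"
  shows "digit_fun (3 ^ m * (2 * of_int i + ternary c)) = c m"
  using c
proof (induction m arbitrary: i c)
  case 0
  \<comment> \<open>\<open>3 * ternary c - 1\<close> is at most 0 or at least 1 according to the
    leading digit, so clipping returns exactly that digit.\<close>
  have "3 * ternary c = 2 * c 0 + ternary (\<lambda>j. c (Suc j))" by (rule ternary_Suc[OF 0])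
  then show ?case
    using 0[of 0] ternary_bounds[of c, OF 0] ternary_bounds[of "\<lambda>j. c (Suc j)", OF 0]
    by (auto simp: digit_fun_def tent_eq max_def min_def simp del: of_int_mult)
next
  case (Suc m)
  obtain k :: int where k: "c 0 = of_int k" using Suc.prems[of 0] by (metis insertE of_int_0 of_int_1 singletonD)
  have "3 ^ Suc m * (2 * of_int i + ternary c) = 3 ^ m * (2 * of_int (3 * i) + 3 * ternary c)"
    by (simp add: algebra_simps)
  also have "3 * ternary c = 2 * of_int k + ternary (\<lambda>j. c (Suc j))"
    using ternary_Suc[of c] Suc.prems k by simp
  also have "2 * of_int (3 * i) + (2 * of_int k + ternary (\<lambda>j. c (Suc j)))
      = 2 * of_int (3 * i + k) + ternary (\<lambda>j. c (Suc j))" by simp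
  finally have eq: "3 ^ Suc m * (2 * of_int i + ternary c)
      = 3 ^ m * (2 * of_int (3 * i + k) + ternary (\<lambda>j. c (Suc j)))" .
  show ?case unfolding eq by (rule Suc.IH[OF Suc.prems])
qed

definition binary_digit :: "nat \<Rightarrow> real \<Rightarrow> real" where
  "binary_digit k x = of_int (\<lfloor>2 ^ Suc k * x\<rfloor> mod 2)"

lemma binary_digit_01: "binary_digit k x \<in> {0, 1}"
  unfolding binary_digit_def by (cases "even \<lfloor>2 ^ Suc k * x\<rfloor>") (auto simp: even_iff_mod_2_eq_zero odd_iff_mod_2_eq_one)

lemma binary_digit_measurable [measurable]: "binary_digit k \<in> borel_measurable borel"
  unfolding binary_digit_def by measurable

text \<open>The partial sums are the truncations \<open>\<lfloor>2 ^ n * x\<rfloor> / 2 ^ n\<close>,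
  which lie below \<open>x\<close> by at most \<open>1 / 2 ^ n\<close>.\<close>

lemma binary_digits_sums:
  assumes "0 \<le> x" "x < 1"
  shows "(\<lambda>k. binary_digit k x / 2 ^ Suc k) sums x"
proof -
  have partial: "(\<Sum>k<n. binary_digit k x / 2 ^ Suc k) = of_int \<lfloor>2 ^ n * x\<rfloor> / 2 ^ n" for n
  proof (induction n)
    case 0
    have "\<lfloor>x\<rfloor> = 0" using assms by linarith
    then show ?case by simp
  next
    case (Suc n)
    have "\<lfloor>2 ^ Suc n * x\<rfloor> div 2 = \<lfloor>2 ^ n * x\<rfloor>"
      using floor_divide_real_eq_div[of 2 "2 ^ Suc n * x"] by simp
    then have "\<lfloor>2 ^ Suc n * x\<rfloor> = 2 * \<lfloor>2 ^ n * x\<rfloor> + \<lfloor>2 ^ Suc n * x\<rfloor> mod 2"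
      by (metis mult_div_mod_eq)
    then have "real_of_int \<lfloor>2 ^ Suc n * x\<rfloor> = 2 * real_of_int \<lfloor>2 ^ n * x\<rfloor> + binary_digit n x"
      unfolding binary_digit_def by (metis of_int_add of_int_mult of_int_numeral)
    then show ?case using Suc.IH by (simp add: field_simps)
  qed
  have "(\<lambda>n. of_int \<lfloor>2 ^ n * x\<rfloor> / 2 ^ n) \<longlonglongrightarrow> x"
  proof (rule tendsto_sandwich[where f = "\<lambda>n. x - (1/2) ^ n" and h = "\<lambda>n. x"])
    have "x - (1/2) ^ n = (2 ^ n * x - 1) / 2 ^ n" for n by (simp add: field_simps)
    moreover have "(2 ^ n * x - 1) / 2 ^ n \<le> of_int \<lfloor>2 ^ n * x\<rfloor> / 2 ^ n" for n
      by (intro divide_right_mono) (linarith, simp)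
    ultimately show "\<forall>\<^sub>F n in sequentially. x - (1/2) ^ n \<le> of_int \<lfloor>2 ^ n * x\<rfloor> / 2 ^ n"
      by simp
    have "of_int \<lfloor>2 ^ n * x\<rfloor> \<le> 2 ^ n * x" for n by linarith
    then show "\<forall>\<^sub>F n in sequentially. of_int \<lfloor>2 ^ n * x\<rfloor> / 2 ^ n \<le> x"
      by (auto simp: field_simps)
    show "(\<lambda>n. x - (1/2) ^ n) \<longlonglongrightarrow> x"
      using tendsto_diff[OF tendsto_const LIMSEQ_power_zero[of "1/2::real"], of x] by simp
  qed simp
  then show ?thesis unfolding sums_def partial .
qed

text \<open>Schoenberg's space-filling curve, blown up so that \<open>[2m, 2m + 1]\<close> covers the cube of radius
  \<open>m\<close>. Its section reads the coordinates' binary digits as ternary digits 0 and 2.\<close>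

definition digit_pos :: "'n::finite \<Rightarrow> nat \<Rightarrow> nat" where
  "digit_pos i k = prod_encode (to_nat_on (UNIV::'n set) i, k)"

text \<open>The pairing function gives each coordinate its own infinite set of ternary positions, so
  digits of different coordinates can be prescribed independently.\<close>

definition cube_curve :: "'n::finite \<Rightarrow> real \<Rightarrow> real" where
  "cube_curve i t = (\<Sum>k. digit_fun (3 ^ digit_pos i k * t) / 2 ^ Suc k)"

text \<open>For an integer \<open>m\<close>, the wave is \<open>t - 2m\<close> on
  \<open>[2m, 2m + 1]\<close>, so the first factor is the constant \<open>m\<close> there; the
  second rescales \<open>[0, 1]\<close> to \<open>[-1, 1]\<close>.\<close>

definition space_curve :: "real \<Rightarrow> real^'n" where
  "space_curve t = (\<chi> i. (t - tent t) / 2 * (2 * cube_curve i t - 1))"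

lemma continuous_on_cube_curve [continuous_intros]:
  "continuous_on UNIV (cube_curve i)"
proof -
  have "uniform_limit UNIV (\<lambda>n t. \<Sum>k<n. digit_fun (3 ^ digit_pos i k * t) / 2 ^ Suc k)
      (cube_curve i) sequentially"
    unfolding cube_curve_def
  proof (rule Weierstrass_m_test[where M = "\<lambda>k. (1/2) ^ Suc k"])
    show "norm (digit_fun (3 ^ digit_pos i k * t) / 2 ^ Suc k) \<le> (1/2) ^ Suc k" for k t
      using digit_fun_bounds[of "3 ^ digit_pos i k * t"] by (auto simp: field_simps)
    show "summable (\<lambda>k. (1/2::real) ^ Suc k)" by (subst summable_Suc_iff) (auto intro: summable_geometric)
  qed
  then show ?thesis
    by (rule uniform_limit_theorem[rotated]) (auto intro!: always_eventually continuous_intros)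
qed

lemma continuous_on_space_curve: "continuous_on UNIV (space_curve :: real \<Rightarrow> real^'n)"
  unfolding space_curve_def by (auto intro!: continuous_intros)

text \<open>Strictly larger than \<open>norm x\<close>, so each coordinate divided by it lies
  strictly between -1 and 1 and, rescaled, in \<open>[0, 1)\<close>, where binary expansions are
  available.\<close>

definition address_index :: "real^'n \<Rightarrow> int" where
  "address_index x = \<lfloor>norm x\<rfloor> + 1"

text \<open>Values of \<open>a\<close> that number no coordinate only fill positions that the curve
  never reads, and the digits there are still 0 or 1.\<close>

definition address :: "real^'n \<Rightarrow> real" where
  "address x = 2 * of_int (address_index x) +
     ternary (\<lambda>j. case prod_decode j of (a, k) \<Rightarrow>
       binary_digit k ((x $ from_nat_into UNIV a / of_int (address_index x) + 1) / 2))"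

lemma space_curve_address: "space_curve (address x) = x"
proof (rule vec_eq_iff[THEN iffD2, rule_format])
  fix i
  define m where "m = real_of_int (address_index x)"
  define c where "c = (\<lambda>j. case prod_decode j of (a, k) \<Rightarrow>
       binary_digit k ((x $ from_nat_into UNIV a / m + 1) / 2))"
  have c: "c j \<in> {0, 1}" for j
    unfolding c_def by (cases "prod_decode j") (simp only: prod.case binary_digit_01)
  have addr: "address x = 2 * of_int (address_index x) + ternary c"
    by (simp add: address_def c_def m_def)
  have m: "norm x < m" unfolding m_def address_index_def by linarith
  then have m0: "m > 0" using norm_ge_zero[of x] by linarith
  have xi: "\<bar>x $ i\<bar> < m" using component_le_norm_cart[of x i] m by linarith
  have "cube_curve i (address x) = (\<Sum>k. binary_digit k ((x $ i / m + 1) / 2) / 2 ^ Suc k)"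
    unfolding cube_curve_def addr digit_fun_ternary[OF c]
    by (simp add: c_def digit_pos_def from_nat_into_to_nat_on countable_finite)
  also have "\<dots> = (x $ i / m + 1) / 2"
    using xi m0 by (intro sums_unique[symmetric] binary_digits_sums) (auto simp: field_simps abs_less_iff)
  finally have "cube_curve i (address x) = (x $ i / m + 1) / 2" .
  moreover have "(address x - tent (address x)) / 2 = m"
    unfolding addr using ternary_bounds[OF c] by (simp add: tent_eq m_def)
  ultimately show "space_curve (address x) $ i = x $ i"
    using m0 by (simp only: space_curve_def vec_lambda_beta) (simp add: field_simps)
qed

text \<open>Linear growth sends balls into bounded intervals, which is how tightness passes from R^n
  to the line.\<close>

lemma address_bounds: "0 \<le> address x" "address x \<le> 2 * norm x + 3"
proof -
  have t: "0 \<le> ternary c" "ternary c \<le> 1" if "c = (\<lambda>j. case prod_decode j of (a, k) \<Rightarrow> binary_digit k (g a))"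
    for c g
    unfolding that
    by (intro ternary_bounds; unfold case_prod_beta; rule binary_digit_01)+
  have "0 \<le> real_of_int (address_index x)" "real_of_int (address_index x) \<le> norm x + 1"
    unfolding address_index_def using norm_ge_zero[of x] by linarith+
  with t[OF refl, of "\<lambda>a. (x $ from_nat_into UNIV a / of_int (address_index x) + 1) / 2"]
  show "0 \<le> address x" "address x \<le> 2 * norm x + 3"
    unfolding address_def by linarith+
qed

lemma address_measurable [measurable]: "address \<in> borel_measurable borel"
proof -
  have [measurable]: "(\<lambda>x::real^'n. x $ i) \<in> borel_measurable borel" for i
    by (intro borel_measurable_continuous_onI continuous_intros)
  have [measurable]: "(\<lambda>x::real^'n. real_of_int (address_index x)) \<in> borel_measurable borel"
    unfolding address_index_def by measurable
  show ?thesis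
    unfolding address_def ternary_def case_prod_beta by measurable
qed

section \<open>Gaussian measures and the continuity theorem\<close>

text \<open>The images under \<open>address\<close> are tight on the line, so Helly's theorem gives
  a weak limit along a subsequence; its image under the curve is the measure sought. Characters
  composed with the continuous curve are admissible test functions, and the curve undoes
  \<open>address\<close>.\<close>

lemma tight_fourier_limit:
  fixes \<sigma> :: "nat \<Rightarrow> (real^'n) measure"
  assumes \<sigma>: "\<And>k. borel_prob (\<sigma> k)"
    and tight: "\<And>e. e > 0 \<Longrightarrow> \<exists>R. \<forall>k. measure (\<sigma> k) {x. norm x > R} < e"
    and lim: "\<And>h. (\<lambda>k. fourier (\<sigma> k) h) \<longlonglongrightarrow> \<psi> h"
  shows "\<exists>\<mu>. borel_prob \<mu> \<and> (\<forall>h. fourier \<mu> h = \<psi> h)"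
proof -
  have [measurable]: "(space_curve :: real \<Rightarrow> real^'n) \<in> borel_measurable borel"
    by (rule borel_measurable_continuous_onI[OF continuous_on_space_curve])
  define \<tau> where "\<tau> k = distr (\<sigma> k) borel address" for k
  have \<tau>: "borel_prob (\<tau> k)" for k
    unfolding \<tau>_def by (intro borel_prob_distr \<sigma>) measurable
  then have rd: "real_distribution (\<tau> k)" for k
    by (auto simp: real_distribution_def real_distribution_axioms_def borel_prob_def)
  have "tight \<tau>" unfolding tight_def
  proof (intro conjI allI impI rd)
    fix e :: real assume "e > 0"
    then obtain R where R: "\<And>k. measure (\<sigma> k) {x. norm x > R} < e" using tight by blast
    \<comment> \<open>The left end lies below 0 because the interval is open there; the absolute
      value of \<open>R\<close> keeps the interval nonempty even for negative
      \<open>R\<close>.\<close>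
    have "1 - e < measure (\<tau> k) {-1<..2 * \<bar>R\<bar> + 3}" for k
    proof -
      interpret prob_space "\<sigma> k" using \<sigma> by (simp add: borel_prob_def)
      have [measurable_cong]: "sets (\<sigma> k) = sets borel" using \<sigma> by (auto simp: borel_prob_def)
      have sp: "space (\<sigma> k) = UNIV" using sets_eq_imp_space_eq[of "\<sigma> k" borel] \<sigma> by (auto simp: borel_prob_def)
      have ev: "{x. norm x > R} \<in> sets (\<sigma> k)"
        using \<sigma>[of k] by (auto simp: borel_prob_def intro!: borel_open open_Collect_less continuous_intros)
      have "1 - e < 1 - measure (\<sigma> k) {x. norm x > R}" using R[of k] by simp
      also have "\<dots> = measure (\<sigma> k) (space (\<sigma> k) - {x. norm x > R})"
        by (simp add: prob_compl ev)
      also have "\<dots> \<le> measure (\<sigma> k) (address -` {-1<..2 * \<bar>R\<bar> + 3} \<inter> space (\<sigma> k))"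
      proof (rule finite_measure_mono)
        have "address x \<in> {-1<..2 * \<bar>R\<bar> + 3}" if "norm x \<le> R" for x :: "real^'n"
          using address_bounds[of x] that by auto
        then show "space (\<sigma> k) - {x. norm x > R} \<subseteq> address -` {-1<..2 * \<bar>R\<bar> + 3} \<inter> space (\<sigma> k)"
          by (auto simp: sp)
      qed measurable
      also have "\<dots> = measure (\<tau> k) {-1<..2 * \<bar>R\<bar> + 3}"
        unfolding \<tau>_def by (subst measure_distr) auto
      finally show ?thesis .
    qed
    then show "\<exists>a b. a < b \<and> (\<forall>n. 1 - e < measure (\<tau> n) {a<..b})"
      by (intro exI[of _ "-1"] exI[of _ "2 * \<bar>R\<bar> + 3"]) auto
  qed
  from tight_imp_convergent_subsubsequence[OF this strict_mono_id]
  obtain r M where r: "strict_mono r" and M: "real_distribution M"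
    and conv: "weak_conv_m (\<tau> \<circ> id \<circ> r) M" by blast
  have Mb: "borel_prob M"
    using M by (auto simp: real_distribution_def real_distribution_axioms_def borel_prob_def)
  define \<mu> where "\<mu> = distr M borel (space_curve :: real \<Rightarrow> real^'n)"
  have "fourier \<mu> h = \<psi> h" for h
  proof (rule LIMSEQ_unique)
    have "(\<lambda>k. CLINT t|(\<tau> \<circ> id \<circ> r) k. iexp (space_curve t \<bullet> h)) \<longlonglongrightarrow> (CLINT t|M. iexp (space_curve t \<bullet> h))"
    proof (rule weak_conv_imp_integral_bdd_continuous_conv[OF _ M conv])
      have "continuous_on UNIV (\<lambda>t. iexp (space_curve t \<bullet> h))"
        by (intro continuous_intros continuous_on_space_curve)
      then show "isCont (\<lambda>t. iexp (space_curve t \<bullet> h)) t" for t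
        by (simp add: continuous_on_eq_continuous_at)
    qed (auto simp: rd)
    moreover have "(CLINT t|(\<tau> \<circ> id \<circ> r) k. iexp (space_curve t \<bullet> h)) = fourier (\<sigma> (r k)) h" for k
      unfolding \<tau>_def fourier_def o_def id_def
      by (subst integral_distr) (use \<sigma> in \<open>auto simp: borel_prob_measurable space_curve_address\<close>)
    moreover have "(CLINT t|M. iexp (space_curve t \<bullet> h)) = fourier \<mu> h"
      unfolding \<mu>_def fourier_def
      by (subst integral_distr) (use Mb in \<open>auto simp: borel_prob_measurable\<close>)
    ultimately show "(\<lambda>k. fourier (\<sigma> (r k)) h) \<longlonglongrightarrow> fourier \<mu> h" by simp
    show "(\<lambda>k. fourier (\<sigma> (r k)) h) \<longlonglongrightarrow> \<psi> h"
      using LIMSEQ_subseq_LIMSEQ[OF lim r] by (simp add: o_def)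
  qed
  moreover have "borel_prob \<mu>" unfolding \<mu>_def by (intro borel_prob_distr Mb) measurable
  ultimately show ?thesis by blast
qed

section \<open>Gaussian measures with possibly degenerate covariance\<close>

definition psd :: "real^'n^'n \<Rightarrow> bool" where
  "psd Q \<longleftrightarrow> transpose Q = Q \<and> (\<forall>h. 0 \<le> (Q *v h) \<bullet> h)"

definition gauss_char :: "real^'n \<Rightarrow> real^'n^'n \<Rightarrow> real^'n \<Rightarrow> complex" where
  "gauss_char m Q h = exp (\<i> * complex_of_real (m \<bullet> h) - complex_of_real ((Q *v h) \<bullet> h / 2))"

lemma psd_commute: "psd Q \<Longrightarrow> (Q *v x) \<bullet> y = x \<bullet> (Q *v y)"
  using dot_lmul_matrix[of x Q y] transpose_matrix_vector[of Q x] by (simp add: psd_def)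

lemma psd_kernel:
  assumes "psd Q" "\<And>x. \<not> 0 < (Q *v x) \<bullet> x"
  shows "(Q *v h) \<bullet> h = 0"
  using assms by (auto simp: psd_def not_less intro: antisym)

text \<open>Induction on the rank: split off the law of \<open>r v\<close> with \<open>r\<close> standard normal, where \<open>v v\<^sup>T\<close> is the
  rank-one part of \<open>Q\<close> in a direction on which \<open>Q\<close> does not vanish.\<close>

lemma ex_fourier_gauss_char:
  fixes Q :: "real^'n^'n"
  assumes "psd Q"
  shows "\<exists>M. borel_prob M \<and> (\<forall>h. fourier M h = gauss_char m Q h)"
  using assms
proof (induction "CARD('n) - dim {x. Q *v x = 0}" arbitrary: Q rule: less_induct)
  case less
  show ?case
  proof (cases "\<exists>x. 0 < (Q *v x) \<bullet> x")
    case False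
    \<comment> \<open>Base case: with vanishing quadratic form the transform is that of the point
      mass at \<open>m\<close>.\<close>
    then have "(Q *v h) \<bullet> h = 0" for h using psd_kernel[OF less.prems] by blast
    then have "fourier (return borel m) h = gauss_char m Q h" for h
      by (simp add: fourier_def gauss_char_def integral_return)
    then show ?thesis
      by (intro exI[of _ "return borel m"]) (auto simp: borel_prob_def prob_space_return)
  next
    case True
    then obtain x where x: "0 < (Q *v x) \<bullet> x" by blast
    define c where "c = (Q *v x) \<bullet> x"
    \<comment> \<open>This normalisation gives \<open>(v \<bullet> x)\<^sup>2 = c\<close>, so
      subtracting the rank-one part from \<open>Q\<close> annihilates \<open>x\<close>.\<close>
    define v where "v = (Q *v x) /\<^sub>R sqrt c"
    define Q' where "Q' = (\<chi> i j. Q $ i $ j - v $ i * v $ j)"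
    have c: "c > 0" using x by (simp add: c_def)
    have Q': "Q' *v y = Q *v y - (v \<bullet> y) *\<^sub>R v" for y
      by (simp add: vec_eq_iff matrix_vector_mult_def Q'_def inner_vec_def algebra_simps
          sum_subtractf sum_distrib_left)
    have v: "v \<bullet> y = ((Q *v x) \<bullet> y) / sqrt c" for y
      by (simp add: v_def divide_inverse)
    have sq: "(v \<bullet> y)\<^sup>2 = ((Q *v x) \<bullet> y)\<^sup>2 / c" for y
      using c by (simp add: v power_divide)
    have quad: "(Q' *v y) \<bullet> y = (Q *v y) \<bullet> y - ((Q *v x) \<bullet> y)\<^sup>2 / c" for y
      using sq[of y] by (simp add: Q' inner_diff_left power2_eq_square)
    have psd': "psd Q'" unfolding psd_def
    proof
      show "transpose Q' = Q'"
        using less.prems unfolding psd_def by (auto simp: vec_eq_iff transpose_def Q'_def)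
      show "\<forall>h. 0 \<le> (Q' *v h) \<bullet> h"
      proof
        fix h
        \<comment> \<open>This \<open>t\<close> minimises the form of \<open>Q\<close> along the
          line through \<open>h\<close> in direction \<open>x\<close>; the minimum is the value of
          the form of \<open>Q'\<close> at \<open>h\<close>.\<close>
        define t where "t = ((Q *v x) \<bullet> h) / c"
        have "0 \<le> (Q *v (h - t *\<^sub>R x)) \<bullet> (h - t *\<^sub>R x)"
          using less.prems unfolding psd_def by blast
        also have "\<dots> = (Q *v h) \<bullet> h - t * ((Q *v h) \<bullet> x) - t * ((Q *v x) \<bullet> h) + t * t * c"
          by (simp add: matrix_vector_mult_diff_distrib matrix_vector_mult_scaleR inner_diff_left
              inner_diff_right c_def algebra_simps)
        also have "(Q *v h) \<bullet> x = (Q *v x) \<bullet> h"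
          using psd_commute[OF less.prems] by (simp add: inner_commute)
        also have "(Q *v h) \<bullet> h - t * ((Q *v x) \<bullet> h) - t * ((Q *v x) \<bullet> h) + t * t * c = (Q' *v h) \<bullet> h"
          using c unfolding quad t_def by (simp add: field_simps power2_eq_square)
        finally show "0 \<le> (Q' *v h) \<bullet> h" .
      qed
    qed
    have sub: "subspace {y. P *v y = 0}" for P :: "real^'n^'n"
      by (auto simp: subspace_def matrix_vector_right_distrib matrix_vector_mult_scaleR)
    \<comment> \<open>The kernel of \<open>Q\<close> survives by symmetry and gains the new element
      \<open>x\<close>, so the rank drops.\<close>
    have "{y. Q *v y = 0} \<subseteq> {y. Q' *v y = 0}"
      using psd_commute[OF less.prems, of x] by (auto simp: Q' v)
    moreover have "Q' *v x = 0"
    proof -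
      have "v \<bullet> x = sqrt c" using c by (simp add: v c_def[symmetric] real_div_sqrt)
      then show ?thesis using c by (simp add: Q' v_def)
    qed
    moreover have "Q *v x \<noteq> 0" using x by auto
    ultimately have "{y. Q *v y = 0} \<subset> {y. Q' *v y = 0}" by blast
    then have "dim {y. Q *v y = 0} < dim {y. Q' *v y = 0}"
      by (intro dim_psubset) (simp only: span_eq_iff[THEN iffD2, OF sub])
    moreover have "dim {y. Q' *v y = 0} \<le> CARD('n)"
      using dim_subset_UNIV_cart by blast
    ultimately have "CARD('n) - dim {y. Q' *v y = 0} < CARD('n) - dim {y. Q *v y = 0}" by linarith
    from less.hyps[OF this psd']
    obtain M where M: "borel_prob M" "\<And>h. fourier M h = gauss_char m Q' h" by blast
    define N where "N = distr std_normal_distribution borel (\<lambda>r. r *\<^sub>R v)"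
    have std: "borel_prob std_normal_distribution"
      using real_dist_normal_dist
      by (auto simp: real_distribution_def real_distribution_axioms_def borel_prob_def)
    have N: "borel_prob N" unfolding N_def by (intro borel_prob_distr std) measurable
    have "fourier N h = complex_of_real (exp (- (v \<bullet> h)\<^sup>2 / 2))" for h
    proof -
      have "fourier N h = char std_normal_distribution (v \<bullet> h)"
        unfolding N_def fourier_def char_def
        by (subst integral_distr) (auto simp: mult.commute)
      then show ?thesis by (simp add: char_std_normal_distribution)
    qed
    then have "fourier (convolution M N) h = gauss_char m Q h" for h
      by (simp add: fourier_convolution M N gauss_char_def exp_of_real[symmetric] exp_add[symmetric]
          quad sq field_simps)
    then show ?thesis using borel_prob_convolution[OF M(1) N] by blast
  qed
qed

text \<open>The definite description is legitimate: existence comes from the rank induction,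
  uniqueness from injectivity of the Fourier transform.\<close>

lemma gaussian_fourier:
  assumes "psd Q"
  shows "borel_prob (gaussian m Q)" "fourier (gaussian m Q) h = gauss_char m Q h"
proof -
  let ?P = "\<lambda>M. borel_prob M \<and>
        (\<forall>h. fourier M h = exp (\<i> * complex_of_real (m \<bullet> h) - complex_of_real ((Q *v h) \<bullet> h / 2)))"
  have "\<exists>!M. ?P M"
    using ex_fourier_gauss_char[OF assms, of m] fourier_unique
    unfolding gauss_char_def by metis
  then have "?P (gaussian m Q)" unfolding gaussian_def by (rule theI')
  then show "borel_prob (gaussian m Q)" "fourier (gaussian m Q) h = gauss_char m Q h"
    by (auto simp: gauss_char_def)
qed

section \<open>Levy's continuity theorem on R^n\<close>

lemma borel_prob_tail_small:
  fixes M :: "'a::real_normed_vector measure"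
  assumes M: "borel_prob M" and e: "e > 0"
  shows "\<exists>R. measure M {x. norm x > R} < e"
proof -
  interpret prob_space M using M by (simp add: borel_prob_def)
  have ev: "{x. norm x > real j} \<in> sets M" for j
    using M by (auto simp: borel_prob_def intro!: borel_open open_Collect_less continuous_intros)
  have "(\<lambda>j. measure M {x. norm x > real j}) \<longlonglongrightarrow> measure M (\<Inter>j. {x. norm x > real j})"
    using ev by (intro finite_Lim_measure_decseq) (auto simp: decseq_def)
  moreover have "(\<Inter>j. {x::'a. norm x > real j}) = {}"
    using reals_Archimedean2 by (auto intro: less_asym)
  ultimately have "(\<lambda>j. measure M {x. norm x > real j}) \<longlonglongrightarrow> 0" by simp
  then have "\<forall>\<^sub>F j in sequentially. measure M {x. norm x > real j} < e"
    using e order_tendstoD(2) by blast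
  then show ?thesis using eventually_happens sequentially_bot by blast
qed

text \<open>Tightness: averaging \<open>fourier \<sigma>\<close> over a Gaussian of standard deviation \<open>a\<close> gives the \<open>\<sigma>\<close>-mean of
  \<open>exp (- a\<^sup>2 |x|\<^sup>2 / 2)\<close>, which controls the tails of \<open>\<sigma>\<close>.\<close>

theorem fourier_levy_continuity:
  fixes \<sigma> :: "nat \<Rightarrow> (real^'n) measure"
  assumes \<sigma>: "\<And>k. borel_prob (\<sigma> k)"
    and lim: "\<And>h. (\<lambda>k. fourier (\<sigma> k) h) \<longlonglongrightarrow> \<psi> h"
    and cont: "isCont \<psi> 0"
  shows "\<exists>\<mu>. borel_prob \<mu> \<and> (\<forall>h. fourier \<mu> h = \<psi> h)"
proof (rule tight_fourier_limit[OF \<sigma> _ lim])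
  fix e :: real assume e: "e > 0"
  define \<gamma> where "\<gamma> = gaussian (0 :: real^'n) (mat 1)"
  have psd1: "psd (mat 1 :: real^'n^'n)" by (simp add: psd_def)
  have \<gamma>: "borel_prob \<gamma>" "\<And>h. fourier \<gamma> h = complex_of_real (exp (- (norm h)\<^sup>2 / 2))"
    using gaussian_fourier[OF psd1, of 0]
    by (auto simp: \<gamma>_def gauss_char_def exp_of_real[symmetric] power2_norm_eq_inner)
  interpret \<gamma>: prob_space \<gamma> using \<gamma> by (simp add: borel_prob_def)
  have [measurable_cong]: "sets \<gamma> = sets borel" using \<gamma> by (simp add: borel_prob_def)
  have fm[measurable]: "fourier (\<sigma> k) \<in> borel_measurable borel" for k
    by (rule borel_measurable_continuous_onI[OF continuous_on_fourier[OF \<sigma>]])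
  have \<psi>m[measurable]: "\<psi> \<in> borel_measurable borel"
    by (rule borel_measurable_LIMSEQ_metric[OF fm lim])
  have \<psi>1: "norm (\<psi> h) \<le> 1" for h
    by (rule LIMSEQ_le_const2[OF tendsto_norm[OF lim]]) (auto simp: norm_fourier_le_1 \<sigma>)
  have \<psi>0: "\<psi> 0 = 1"
    using lim[of 0] by (simp add: fourier_0 \<sigma> LIMSEQ_const_iff)
  have swap: "(CLINT h|\<gamma>. fourier (\<sigma> k) (a *\<^sub>R h)) = complex_of_real (LINT x|\<sigma> k. exp (- a\<^sup>2 * (norm x)\<^sup>2 / 2))" for k a
  proof -
    interpret S: prob_space "\<sigma> k" using \<sigma> by (simp add: borel_prob_def)
    interpret P: pair_prob_space \<gamma> "\<sigma> k" ..
    have [measurable_cong]: "sets (\<sigma> k) = sets borel" using \<sigma> by (simp add: borel_prob_def)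
    have "(CLINT h|\<gamma>. fourier (\<sigma> k) (a *\<^sub>R h)) = (CLINT h|\<gamma>. CLINT x|\<sigma> k. iexp (x \<bullet> (a *\<^sub>R h)))"
      by (simp add: fourier_def)
    also have "\<dots> = (CLINT x|\<sigma> k. CLINT h|\<gamma>. iexp (x \<bullet> (a *\<^sub>R h)))"
      by (rule P.Fubini_integral[symmetric]) (auto intro!: P.integrable_const_bound[of _ 1] simp: case_prod_beta)
    also have "\<dots> = (CLINT x|\<sigma> k. fourier \<gamma> (a *\<^sub>R x))"
      by (simp add: fourier_def inner_commute)
    also have "\<dots> = (CLINT x|\<sigma> k. complex_of_real (exp (- a\<^sup>2 * (norm x)\<^sup>2 / 2)))"
      by (simp add: \<gamma> power_mult_distrib)
    finally show ?thesis by simp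
  qed
  \<comment> \<open>As the width \<open>1 / real (Suc j)\<close> shrinks, continuity of
    \<open>\<psi>\<close> at 0 with \<open>\<psi> 0 = 1\<close> makes its Gaussian average tend to
    1.\<close>
  have "(\<lambda>j. CLINT h|\<gamma>. \<psi> ((1 / real (Suc j)) *\<^sub>R h)) \<longlonglongrightarrow> (CLINT h|\<gamma>. 1)"
  proof (rule integral_dominated_convergence[where w = "\<lambda>_. 1"])
    have "(\<lambda>j. (1 / real (Suc j)) *\<^sub>R h) \<longlonglongrightarrow> 0" for h :: "real^'n"
      using tendsto_scaleR[OF LIMSEQ_Suc[OF lim_1_over_n] tendsto_const[of h]] by simp
    then have "(\<lambda>j. \<psi> ((1 / real (Suc j)) *\<^sub>R h)) \<longlonglongrightarrow> 1" for h
      using isCont_tendsto_compose[OF cont] \<psi>0 by fastforce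
    then show "AE h in \<gamma>. (\<lambda>j. \<psi> ((1 / real (Suc j)) *\<^sub>R h)) \<longlonglongrightarrow> 1" by simp
  qed (use \<psi>1 in auto)
  then have "(\<lambda>j. CLINT h|\<gamma>. \<psi> ((1 / real (Suc j)) *\<^sub>R h)) \<longlonglongrightarrow> 1"
    by (simp add: \<gamma>.prob_space)
  \<comment> \<open>Half of \<open>e\<close>, because the tail estimate below costs a factor
    2.\<close>
  then have "\<forall>\<^sub>F j in sequentially. dist (CLINT h|\<gamma>. \<psi> ((1 / real (Suc j)) *\<^sub>R h)) 1 < e / 2"
    using e by (intro tendstoD) auto
  then obtain j where j: "dist (CLINT h|\<gamma>. \<psi> ((1 / real (Suc j)) *\<^sub>R h)) 1 < e / 2"
    using eventually_happens sequentially_bot by blast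
  define a where "a = 1 / real (Suc j)"
  have a: "a > 0" by (simp add: a_def)
  \<comment> \<open>With \<open>a\<close> fixed, the averages for \<open>\<sigma> k\<close> inherit
    the estimate from \<open>\<psi>\<close> for all large \<open>k\<close>.\<close>
  have "(\<lambda>k. CLINT h|\<gamma>. fourier (\<sigma> k) (a *\<^sub>R h)) \<longlonglongrightarrow> (CLINT h|\<gamma>. \<psi> (a *\<^sub>R h))"
    by (rule integral_dominated_convergence[where w = "\<lambda>_. 1"]) (use lim norm_fourier_le_1[OF \<sigma>] in auto)
  then have "(\<lambda>k. dist (CLINT h|\<gamma>. fourier (\<sigma> k) (a *\<^sub>R h)) 1) \<longlonglongrightarrow> dist (CLINT h|\<gamma>. \<psi> (a *\<^sub>R h)) 1"
    by (intro tendsto_intros)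
  then have "\<forall>\<^sub>F k in sequentially. dist (CLINT h|\<gamma>. fourier (\<sigma> k) (a *\<^sub>R h)) 1 < e / 2"
    using j unfolding a_def by (rule order_tendstoD(2))
  then obtain K where K: "\<And>k. k \<ge> K \<Longrightarrow> dist (CLINT h|\<gamma>. fourier (\<sigma> k) (a *\<^sub>R h)) 1 < e / 2"
    by (auto simp: eventually_sequentially)
  \<comment> \<open>Beyond radius \<open>2 / a\<close> the exponential is at most 1/2, so twice its
    distance from 1 dominates the indicator.\<close>
  define R0 where "R0 = 2 / a"
  have tail: "measure (\<sigma> k) {x. norm x > R0} < e" if "k \<ge> K" for k
  proof -
    interpret S: prob_space "\<sigma> k" using \<sigma> by (simp add: borel_prob_def)
    have ev: "{x. norm x > R0} \<in> sets (\<sigma> k)"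
      using \<sigma>[of k] by (auto simp: borel_prob_def intro!: borel_open open_Collect_less continuous_intros)
    have int: "integrable (\<sigma> k) (\<lambda>x. exp (- a\<^sup>2 * (norm x)\<^sup>2 / 2))"
      by (rule borel_prob_integrable[OF \<sigma>, where c = 1]) auto
    have small: "indicator {x. norm x > R0} x \<le> 2 * (1 - exp (- a\<^sup>2 * (norm x)\<^sup>2 / 2))" for x :: "real^'n"
    proof (cases "norm x > R0")
      case True
      then have "a * norm x > 2" using a by (simp add: R0_def field_simps)
      then have "(a * norm x)\<^sup>2 \<ge> 2\<^sup>2" by (intro power_mono) auto
      then have "a\<^sup>2 * (norm x)\<^sup>2 / 2 \<ge> 1" by (simp add: power_mult_distrib)
      then have "exp (1::real) \<le> exp (a\<^sup>2 * (norm x)\<^sup>2 / 2)" by simp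
      then have "2 \<le> exp (a\<^sup>2 * (norm x)\<^sup>2 / 2)"
        using exp_ge_add_one_self[of "1::real"] by linarith
      then have "exp (- (a\<^sup>2 * (norm x)\<^sup>2 / 2)) \<le> 1 / 2"
        unfolding exp_minus by (simp add: field_simps)
      then show ?thesis using True by simp
    qed simp
    have "measure (\<sigma> k) {x. norm x > R0} = (LINT x|\<sigma> k. indicator {x. norm x > R0} x)"
      using ev by simp
    also have "\<dots> \<le> (LINT x|\<sigma> k. 2 * (1 - exp (- a\<^sup>2 * (norm x)\<^sup>2 / 2)))"
      using int small integrable_real_indicator[OF ev]
      by (intro integral_mono) (auto simp: S.emeasure_eq_measure)
    also have "\<dots> = 2 * (1 - (LINT x|\<sigma> k. exp (- a\<^sup>2 * (norm x)\<^sup>2 / 2)))"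
      using int by (simp add: S.prob_space)
    also have "\<dots> < e"
    proof -
      have "\<bar>(LINT x|\<sigma> k. exp (- a\<^sup>2 * (norm x)\<^sup>2 / 2)) - 1\<bar> < e / 2"
        using K[OF that] norm_of_real[of "(LINT x|\<sigma> k. exp (- a\<^sup>2 * (norm x)\<^sup>2 / 2)) - 1", where ?'a = complex]
        unfolding swap dist_norm by simp
      moreover have "2 * (1 - E) < e" if "\<bar>E - 1\<bar> < e / 2" for E :: real
      proof -
        have "1 - E \<le> \<bar>E - 1\<bar>" by simp
        also note that
        finally show ?thesis by simp
      qed
      ultimately show ?thesis by blast
    qed
    finally show ?thesis .
  qed
  have "\<forall>k. \<exists>R. measure (\<sigma> k) {x. norm x > R} < e" using borel_prob_tail_small[OF \<sigma> e] by blast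
  then obtain Rk where Rk: "\<And>k. measure (\<sigma> k) {x. norm x > Rk k} < e" by metis
  \<comment> \<open>The finitely many indices below \<open>K\<close> each have their own radius; the
    maximum with \<open>R0\<close> serves all of them.\<close>
  define R where "R = Max (insert R0 (Rk ` {..<K}))"
  show "\<exists>R. \<forall>k. measure (\<sigma> k) {x. norm x > R} < e"
  proof (intro exI allI)
    fix k
    interpret S: prob_space "\<sigma> k" using \<sigma> by (simp add: borel_prob_def)
    have ev: "{x. norm x > r} \<in> sets (\<sigma> k)" for r
      using \<sigma>[of k] by (auto simp: borel_prob_def intro!: borel_open open_Collect_less continuous_intros)
    obtain r where r: "r \<le> R" "measure (\<sigma> k) {x. norm x > r} < e"
      using tail[of k] Rk[of k] that[of R0] that[of "Rk k"] by (cases "k < K") (auto simp: R_def)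
    have "measure (\<sigma> k) {x. norm x > R} \<le> measure (\<sigma> k) {x. norm x > r}"
      using r(1) by (intro S.finite_measure_mono ev) auto
    then show "measure (\<sigma> k) {x. norm x > R} < e" using r(2) by simp
  qed
qed

section \<open>Exponentially stable evolution families\<close>

lemma bounded_bilinear_matrix_mult:
  "bounded_bilinear ((**) :: real^'n^'m \<Rightarrow> real^'p^'n \<Rightarrow> real^'p^'m)"
  unfolding bilinear_conv_bounded_bilinear[symmetric] bilinear_def linear_iff
  by (auto simp: vec_eq_iff matrix_matrix_mult_def distrib_left distrib_right sum.distrib
      sum_distrib_left mult_ac)

lemma bounded_bilinear_matrix_vector_mult:
  "bounded_bilinear ((*v) :: real^'n^'m \<Rightarrow> real^'n \<Rightarrow> real^'m)"
  unfolding bilinear_conv_bounded_bilinear[symmetric] bilinear_def linear_iff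
  by (auto simp: matrix_vector_mult_add_rdistrib matrix_vector_right_distrib
      matrix_vector_mult_scaleR scaleR_matrix_vector_assoc)

lemma bounded_linear_transpose:
  "bounded_linear (transpose :: real^'n^'m \<Rightarrow> real^'m^'n)"
  unfolding linear_conv_bounded_linear[symmetric] linear_iff
  by (auto simp: vec_eq_iff transpose_def)

lemma inner_matrix_vector_mult:
  fixes M :: "real^'n^'m"
  shows "(M *v x) \<bullet> y = x \<bullet> (transpose M *v y)"
  by (metis dot_lmul_matrix inner_commute transpose_matrix_vector)

text \<open>Gronwall's argument for the squared Frobenius norm, in both time directions.\<close>

lemma linear_ode_zero:
  fixes A W :: "real \<Rightarrow> real^'n^'n"
  assumes A: "bounded (range A)"
    and W: "\<And>t. (W has_vector_derivative A t ** W t) (at t)"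
    and W0: "W s = 0"
  shows "W t = 0"
proof -
  obtain a where a: "\<And>t. norm (A t) \<le> a" using A by (auto simp: bounded_iff)
  obtain b where b: "b > 0" "\<And>(X::real^'n^'n) (Y::real^'n^'n). norm (X ** Y) \<le> norm X * norm Y * b"
    using bounded_bilinear.pos_bounded[OF bounded_bilinear_matrix_mult] by blast
  define c where "c = a * b"
  have bd: "\<bar>W t \<bullet> (A t ** W t)\<bar> \<le> c * (W t \<bullet> W t)" for t
  proof -
    have "\<bar>W t \<bullet> (A t ** W t)\<bar> \<le> norm (W t) * norm (A t ** W t)" by (rule Cauchy_Schwarz_ineq2)
    also have "\<dots> \<le> norm (W t) * (norm (A t) * norm (W t) * b)"
      by (rule mult_left_mono[OF b(2)]) simp
    also have "\<dots> \<le> norm (W t) * (a * norm (W t) * b)"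
      using b(1) a by (intro mult_left_mono mult_right_mono) auto
    finally show ?thesis by (simp add: c_def dot_square_norm power2_eq_square mult_ac)
  qed
  have der: "((\<lambda>t. W t \<bullet> W t) has_real_derivative 2 * (W t \<bullet> (A t ** W t))) (at t)" for t
    using bounded_bilinear.has_vector_derivative[OF bounded_bilinear_inner W[of t] W[of t]]
    by (simp add: has_real_derivative_iff_has_vector_derivative inner_commute)
  have "W t \<bullet> W t = 0"
  proof (cases "s \<le> t")
    case True
    have "exp (- 2 * c * t) * (W t \<bullet> W t) \<le> exp (- 2 * c * s) * (W s \<bullet> W s)"
    proof (rule DERIV_nonpos_imp_nonincreasing[OF True])
      fix x
      have "((\<lambda>t. exp (- 2 * c * t) * (W t \<bullet> W t)) has_real_derivative
          exp (- 2 * c * x) * (2 * (W x \<bullet> (A x ** W x)) - 2 * c * (W x \<bullet> W x))) (at x)"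
        by (rule derivative_eq_intros der refl | simp add: algebra_simps)+
      moreover have "exp (- 2 * c * x) * (2 * (W x \<bullet> (A x ** W x)) - 2 * c * (W x \<bullet> W x)) \<le> 0"
        using bd[of x] by (intro mult_nonneg_nonpos) auto
      ultimately show "\<exists>y. ((\<lambda>t. exp (- 2 * c * t) * (W t \<bullet> W t)) has_real_derivative y) (at x) \<and> y \<le> 0" by blast
    qed
    then have "W t \<bullet> W t \<le> 0" using W0 by (simp add: mult_le_0_iff)
    then show ?thesis using inner_ge_zero[of "W t"] by linarith
  next
    case False
    then have "t \<le> s" by simp
    \<comment> \<open>Backward in time the integrating factor has the opposite sign, and the product
      is nondecreasing up to \<open>s\<close>, where it is 0.\<close>
    have "exp (2 * c * t) * (W t \<bullet> W t) \<le> exp (2 * c * s) * (W s \<bullet> W s)"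
    proof (rule DERIV_nonneg_imp_nondecreasing[OF \<open>t \<le> s\<close>])
      fix x
      have "((\<lambda>t. exp (2 * c * t) * (W t \<bullet> W t)) has_real_derivative
          exp (2 * c * x) * (2 * (W x \<bullet> (A x ** W x)) + 2 * c * (W x \<bullet> W x))) (at x)"
        by (rule derivative_eq_intros der refl | simp add: algebra_simps)+
      moreover have "exp (2 * c * x) * (2 * (W x \<bullet> (A x ** W x)) + 2 * c * (W x \<bullet> W x)) \<ge> 0"
        using bd[of x] by (intro mult_nonneg_nonneg) auto
      ultimately show "\<exists>y. ((\<lambda>t. exp (2 * c * t) * (W t \<bullet> W t)) has_real_derivative y) (at x) \<and> y \<ge> 0" by blast
    qed
    then have "W t \<bullet> W t \<le> 0" using W0 by (simp add: mult_le_0_iff)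
    then show ?thesis using inner_ge_zero[of "W t"] by linarith
  qed
  then show ?thesis by simp
qed

text \<open>As functions of the first time both sides solve the same linear equation and agree at
  \<open>s\<close>; uniqueness gives equality for times in any order.\<close>

lemma evolution_family_cocycle:
  assumes U: "evolution_family A U" and A: "bounded (range A)"
  shows "U t s ** U s r = U t r"
proof -
  define W where "W \<tau> = U \<tau> s ** U s r - U \<tau> r" for \<tau>
  have "(W has_vector_derivative A \<tau> ** W \<tau>) (at \<tau>)" for \<tau>
  proof -
    have d: "((\<lambda>\<tau>. U \<tau> q) has_vector_derivative A \<tau> ** U \<tau> q) (at \<tau>)" for q
      using U by (simp add: evolution_family_def)
    have "((\<lambda>\<tau>. U \<tau> s ** U s r) has_vector_derivative (A \<tau> ** U \<tau> s) ** U s r) (at \<tau>)"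
      by (rule bounded_linear.has_vector_derivative
          [OF bounded_bilinear.bounded_linear_left[OF bounded_bilinear_matrix_mult] d])
    from has_vector_derivative_diff[OF this d[of r]]
    show ?thesis
      unfolding W_def
      by (simp add: bounded_bilinear.diff_right[OF bounded_bilinear_matrix_mult] matrix_mul_assoc)
  qed
  moreover have "W s = 0" using U by (simp add: W_def evolution_family_def)
  ultimately have "W t = 0" using linear_ode_zero[OF A] by blast
  then show ?thesis by (simp add: W_def)
qed

text \<open>The growth bound is stated in the operator norm, while later estimates use the Frobenius
  norm; each entry is bounded by the operator norm.\<close>

lemma norm_le_onorm_matrix:
  fixes X :: "real^'n^'m"
  shows "norm X \<le> real CARD('m) * real CARD('n) * onorm ((*v) X)"
proof -
  have "norm X \<le> (\<Sum>i\<in>UNIV. norm (X $ i))" unfolding norm_vec_def by (rule L2_set_le_sum) simp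
  also have "\<dots> \<le> (\<Sum>i\<in>UNIV. \<Sum>j\<in>UNIV. \<bar>X $ i $ j\<bar>)" by (intro sum_mono norm_le_l1_cart)
  also have "\<dots> \<le> (\<Sum>i\<in>(UNIV::'m set). \<Sum>j\<in>(UNIV::'n set). onorm ((*v) X))"
    by (intro sum_mono matrix_component_le_onorm)
  finally show ?thesis by simp
qed

lemma growth_bound_neg:
  fixes U :: "real \<Rightarrow> real \<Rightarrow> real^'n^'n"
  assumes "growth_bound U < 0"
  obtains C \<omega> where "C > 0" "\<omega> < 0" "\<And>s t. s \<le> t \<Longrightarrow> norm (U t s) \<le> C * exp (\<omega> * (t - s))"
proof -
  obtain \<omega> M where \<omega>: "\<omega> < 0"
    and M: "\<And>s t. s \<le> t \<Longrightarrow> onorm ((*v) (U t s)) \<le> M * exp (\<omega> * (t - s))"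
    using assms unfolding growth_bound_def Inf_less_iff by auto
  let ?N = "real CARD('n) * real CARD('n)"
  \<comment> \<open>Replacing \<open>M\<close> by \<open>\<bar>M\<bar> + 1\<close> makes the
    constant positive.\<close>
  have "norm (U t s) \<le> (?N * (\<bar>M\<bar> + 1)) * exp (\<omega> * (t - s))" if "s \<le> t" for s t
  proof -
    have "norm (U t s) \<le> ?N * onorm ((*v) (U t s))" by (rule norm_le_onorm_matrix)
    also have "\<dots> \<le> ?N * ((\<bar>M\<bar> + 1) * exp (\<omega> * (t - s)))"
      by (intro mult_left_mono order_trans[OF M[OF that]] mult_right_mono) auto
    finally show ?thesis by (simp add: mult_ac)
  qed
  moreover have "?N * (\<bar>M\<bar> + 1) > 0" by (intro mult_pos_pos) auto
  ultimately show ?thesis using \<omega> that by blast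
qed

text \<open>The equation gives regularity in the first time only; the cocycle identity transfers it
  to the second. Continuity at \<open>r0\<close> is first shown with final time
  \<open>r0 + 1\<close>, so that the exponential bound covers both sides of \<open>r0\<close>;
  multiplication by \<open>U t T\<close> then reaches every \<open>t\<close>.\<close>

lemma evolution_family_continuous_right:
  fixes U :: "real \<Rightarrow> real \<Rightarrow> real^'n^'n"
  assumes U: "evolution_family A U" and coc: "\<And>t s r. U t s ** U s r = U t r"
    and C: "\<And>s t. s \<le> t \<Longrightarrow> norm (U t s) \<le> C * exp (\<omega> * (t - s))" "\<omega> < 0" "C > 0"
  shows "continuous_on UNIV (\<lambda>r. U t r)"
proof -
  note bb = bounded_bilinear_matrix_mult
  have Ucont: "isCont (\<lambda>\<tau>. U \<tau> s) t" for t s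
    using U has_vector_derivative_continuous unfolding evolution_family_def by blast
  have "((\<lambda>r. U t r) \<longlongrightarrow> U t r0) (at r0)" for r0
  proof -
    define T where "T = r0 + 1"
    \<comment> \<open>\<open>U T r - U T r0 = U T r ** (U r0 r0 - U r r0)\<close>, and the first factor is bounded for \<open>r \<le> T\<close>.\<close>
    have "((\<lambda>r. U r0 r0 - U r r0) \<longlongrightarrow> 0) (at r0)"
      using tendsto_diff[OF tendsto_const Ucont[unfolded isCont_def, of r0 r0], of "U r0 r0"] by simp
    moreover have "Bfun (\<lambda>r. U T r) (at r0)"
    proof (rule BfunI)
      have "\<forall>\<^sub>F r in at r0. r < T"
        by (rule order_tendstoD(2)[OF tendsto_ident_at]) (simp add: T_def)
      then show "\<forall>\<^sub>F r in at r0. norm (U T r) \<le> C"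
      proof eventually_elim
        case (elim r)
        have "exp (\<omega> * (T - r)) \<le> 1" using elim C(2) by (simp add: mult_nonpos_nonneg)
        then have "C * exp (\<omega> * (T - r)) \<le> C" using C(3) by simp
        then show ?case using C(1)[of r T] elim by simp
      qed
    qed
    ultimately have "Zfun (\<lambda>r. U T r ** (U r0 r0 - U r r0)) (at r0)"
      by (intro bounded_bilinear.Bfun_prod_Zfun[OF bb]) (simp_all add: tendsto_Zfun_iff)
    then have "((\<lambda>r. U T r - U T r0) \<longlongrightarrow> 0) (at r0)"
      using U by (simp add: tendsto_Zfun_iff bounded_bilinear.diff_right[OF bb] coc evolution_family_def)
    then have "((\<lambda>r. U T r) \<longlongrightarrow> U T r0) (at r0)" by (rule LIM_zero_cancel)
    then have "((\<lambda>r. U t T ** U T r) \<longlongrightarrow> U t T ** U T r0) (at r0)"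
      by (intro bounded_bilinear.tendsto[OF bb] tendsto_const)
    then show ?thesis by (simp add: coc)
  qed
  then show ?thesis by (simp add: continuous_on_eq_continuous_at isCont_def)
qed

section \<open>Integrals over half-lines with exponential decay\<close>

lemma interval_integral_bounded_linear:
  fixes g :: "real \<Rightarrow> 'a::{banach, second_countable_topology}"
    and T :: "'a \<Rightarrow> 'b::{banach, second_countable_topology}"
  assumes T: "bounded_linear T" and g: "interval_lebesgue_integrable lborel a b g"
  shows "(LBINT r=a..b. T (g r)) = T (LBINT r=a..b. g r)"
proof -
  interpret T: bounded_linear T by fact
  show ?thesis
    using g integral_bounded_linear[OF T]
    unfolding interval_lebesgue_integral_def interval_lebesgue_integrable_def
      set_lebesgue_integral_def set_integrable_def
    by (auto simp: T.scaleR[symmetric] T.neg[symmetric] split: if_splits)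
qed

text \<open>The majorant is a multiple of the exponential density of rate \<open>- a\<close>,
  reflected and shifted to end at \<open>t\<close>; it is integrable because the density has total
  mass 1.\<close>

lemma exponential_set_integrable:
  fixes h :: "real \<Rightarrow> 'a::{banach, second_countable_topology}"
  assumes "continuous_on UNIV h" and "\<And>r. r \<le> t \<Longrightarrow> norm (h r) \<le> c * exp (a * (t - r))" and a: "a < 0"
  shows "set_integrable lborel {..t} h"
proof (rule set_integrable_bound)
  have "(\<integral>\<^sup>+x. ennreal (exponential_density (- a) x) \<partial>lborel) = 1"
    using prob_space.emeasure_space_1[OF prob_space_exponential_density[of "- a"]] a
    by (simp add: emeasure_density)
  then have "integrable lborel (exponential_density (- a))"
    using a by (intro integrableI_nonneg) (auto simp: exponential_density_nonneg)
  from lborel_integrable_real_affine[OF this, of "-1" t]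
  have "integrable lborel (\<lambda>r. (c / (- a)) * exponential_density (- a) (t - r))" by simp
  also have "(\<lambda>r. (c / (- a)) * exponential_density (- a) (t - r))
      = (\<lambda>r. indicator {..t} r *\<^sub>R (c * exp (a * (t - r))))"
    using a by (auto simp: exponential_density_def fun_eq_iff algebra_simps)
  finally show "set_integrable lborel {..t} (\<lambda>r. c * exp (a * (t - r)))"
    unfolding set_integrable_def .
  show "set_borel_measurable lborel {..t} h"
    using borel_measurable_continuous_onI[OF assms(1)] by (simp add: set_borel_measurable_def)
  show "AE r in lborel. r \<in> {..t} \<longrightarrow> norm (h r) \<le> norm (c * exp (a * (t - r)))"
    using assms(2) by (fastforce intro!: AE_I2)
qed

lemma interval_integrable_below:
  assumes "set_integrable lborel {..t} h" "a \<le> ereal t"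
  shows "interval_lebesgue_integrable lborel a (ereal t) h"
proof -
  have "set_integrable lborel (einterval a t) h"
    by (rule set_integrable_subset[OF assms(1)]) (auto simp: einterval_iff)
  then show ?thesis using assms(2) by (simp add: interval_lebesgue_integrable_def)
qed

lemma interval_integral_below_split:
  fixes h :: "real \<Rightarrow> 'a::{banach, second_countable_topology}"
  assumes "set_integrable lborel {..t} h" "s \<le> t"
  shows "(LBINT r=-\<infinity>..ereal t. h r) = (LBINT r=-\<infinity>..ereal s. h r) + (LBINT r=ereal s..ereal t. h r)"
proof -
  have "interval_lebesgue_integrable lborel (-\<infinity>) (ereal t) h"
    by (rule interval_integrable_below[OF assms(1)]) simp
  then show ?thesis
    using interval_integral_sum[of "-\<infinity>" "ereal s" "ereal t" h] assms(2) by (simp add: max_def)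
qed

text \<open>Dominated convergence with the norm of the integrand as majorant; for each
  \<open>r\<close> the truncated integrands are eventually constant in \<open>k\<close>.\<close>

lemma interval_integral_below_tendsto:
  fixes h :: "real \<Rightarrow> 'a::{banach, second_countable_topology}"
  assumes "set_integrable lborel {..t} h"
  shows "(\<lambda>k. LBINT r=ereal (t - real k)..ereal t. h r) \<longlonglongrightarrow> (LBINT r=-\<infinity>..ereal t. h r)"
proof -
  have int: "set_integrable lborel {..<t} h"
    by (rule set_integrable_subset[OF assms]) auto
  have "(\<lambda>k. LINT r|lborel. indicator {t - real k<..<t} r *\<^sub>R h r) \<longlonglongrightarrow> (LINT r|lborel. indicator {..<t} r *\<^sub>R h r)"
  proof (rule integral_dominated_convergence[where w = "\<lambda>r. norm (indicator {..<t} r *\<^sub>R h r)"])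
    show "(\<lambda>r. indicator {..<t} r *\<^sub>R h r) \<in> borel_measurable lborel"
      using int by (auto simp: set_integrable_def)
    show "integrable lborel (\<lambda>r. norm (indicator {..<t} r *\<^sub>R h r))"
      using int unfolding set_integrable_def by (rule integrable_norm)
    show "(\<lambda>r. indicator {t - real k<..<t} r *\<^sub>R h r) \<in> borel_measurable lborel" for k
    proof -
      have "set_integrable lborel {t - real k<..<t} h"
        by (rule set_integrable_subset[OF assms]) auto
      then show ?thesis by (auto simp: set_integrable_def)
    qed
    show "AE r in lborel. norm (indicator {t - real k<..<t} r *\<^sub>R h r) \<le> norm (indicator {..<t} r *\<^sub>R h r)" for k
      by (auto simp: indicator_def)
    show "AE r in lborel. (\<lambda>k. indicator {t - real k<..<t} r *\<^sub>R h r) \<longlonglongrightarrow> indicator {..<t} r *\<^sub>R h r"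
    proof (rule AE_I2)
      fix r
      obtain k0 where k0: "t - r < real k0" using reals_Archimedean2 by blast
      have "\<forall>\<^sub>F k in sequentially. indicator {t - real k<..<t} r *\<^sub>R h r = indicator {..<t} r *\<^sub>R h r"
        using eventually_ge_at_top[of k0]
      proof eventually_elim
        case (elim k)
        then have "real k0 \<le> real k" by simp
        then show ?case using k0 by (auto simp: indicator_def)
      qed
      then show "(\<lambda>k. indicator {t - real k<..<t} r *\<^sub>R h r) \<longlonglongrightarrow> indicator {..<t} r *\<^sub>R h r"
        by (rule tendsto_eventually)
    qed
  qed
  then show ?thesis by (simp add: interval_lebesgue_integral_def set_lebesgue_integral_def)
qed

section \<open>Evolution systems of measures\<close>

text \<open>From here on the evolution equation enters through the cocycle identity, continuity in
  the second time and the exponential bound.\<close>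

locale ornstein_uhlenbeck =
  fixes U :: "real \<Rightarrow> real \<Rightarrow> real^'n^'n" and B :: "real \<Rightarrow> real^'n^'n" and f :: "real \<Rightarrow> real^'n"
    and C \<omega> :: real
  assumes U_id: "U s s = mat 1"
    and U_mult: "U t s ** U s r = U t r"
    and U_cont: "continuous_on UNIV (\<lambda>r. U t r)"
    and U_bound: "s \<le> t \<Longrightarrow> norm (U t s) \<le> C * exp (\<omega> * (t - s))"
    and \<omega>: "\<omega> < 0" and C: "0 < C"
    and B_cont: "continuous_on UNIV B" and B_bounded: "bounded (range B)"
    and f_cont: "continuous_on UNIV f" and f_bounded: "bounded (range f)"
begin

abbreviation drift_fun :: "real \<Rightarrow> real \<Rightarrow> real^'n" where
  "drift_fun t r \<equiv> U t r *v f r"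

abbreviation cov_fun :: "real \<Rightarrow> real \<Rightarrow> real^'n^'n" where
  "cov_fun t r \<equiv> U t r ** B r ** transpose (B r) ** transpose (U t r)"

lemmas matrix_cont = bounded_bilinear.continuous_on[OF bounded_bilinear_matrix_mult]
lemmas vector_cont = bounded_bilinear.continuous_on[OF bounded_bilinear_matrix_vector_mult]
lemmas transpose_cont = bounded_linear.continuous_on[OF bounded_linear_transpose]

lemma U_mult_vec: "U t s *v (U s r *v x) = U t r *v x"
  by (simp add: matrix_vector_mul_assoc U_mult)

lemma U_transpose_mult_vec: "transpose (U s r) *v (transpose (U t s) *v x) = transpose (U t r) *v x"
  by (simp only: matrix_vector_mul_assoc matrix_transpose_mul[symmetric] U_mult)

section \<open>Drift and covariance integrals\<close>

lemma drift_set_integrable: "set_integrable lborel {..t} (drift_fun t)"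
proof -
  obtain b where b: "\<And>r. norm (f r) \<le> b" using f_bounded by (auto simp: bounded_iff)
  obtain K where K: "K > 0" "\<And>(X::real^'n^'n) (y::real^'n). norm (X *v y) \<le> norm X * norm y * K"
    using bounded_bilinear.pos_bounded[OF bounded_bilinear_matrix_vector_mult] by blast
  show ?thesis
  proof (rule exponential_set_integrable[OF _ _ \<omega>])
    show "continuous_on UNIV (drift_fun t)" by (intro vector_cont U_cont f_cont)
    fix r assume "r \<le> t"
    have "norm (drift_fun t r) \<le> norm (U t r) * norm (f r) * K" by (rule K)
    also have "\<dots> \<le> (C * exp (\<omega> * (t - r))) * b * K"
      using K(1) C b U_bound[OF \<open>r \<le> t\<close>] by (intro mult_mono mult_right_mono) auto
    finally show "norm (drift_fun t r) \<le> (C * b * K) * exp (\<omega> * (t - r))" by (simp add: mult_ac)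
  qed
qed

lemma cov_set_integrable: "set_integrable lborel {..t} (cov_fun t)"
proof -
  note mm = bounded_bilinear_matrix_mult and bt = bounded_linear_transpose
  obtain b where b: "\<And>r. norm (B r) \<le> b" using B_bounded by (auto simp: bounded_iff)
  have b0: "b \<ge> 0" using norm_ge_zero b by (rule order_trans)
  obtain K where K: "K > 0" "\<And>(X::real^'n^'n) (Y::real^'n^'n). norm (X ** Y) \<le> norm X * norm Y * K"
    using bounded_bilinear.pos_bounded[OF mm] by blast
  obtain L where L: "L > 0" "\<And>(X::real^'n^'n). norm (transpose X) \<le> norm X * L"
    using bounded_linear.pos_bounded[OF bt] by blast
  define D where "D = C * b * K * (b * L) * K * (C * L) * K"
  have "norm (cov_fun t r) \<le> D * exp (\<omega> * (t - r))" if "r \<le> t" for r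
  proof -
    define e where "e = exp (\<omega> * (t - r))"
    have e: "0 < e" "e \<le> 1" using \<omega> that by (auto simp: e_def mult_nonpos_nonneg)
    have u: "norm (U t r) \<le> C * e" using U_bound[OF that] by (simp add: e_def)
    \<comment> \<open>Only one of the two evolution factors keeps its decay; the other is bounded by
      a constant, which leaves a majorant of rate \<open>\<omega>\<close>.\<close>
    have ut: "norm (transpose (U t r)) \<le> C * L"
    proof -
      have "norm (transpose (U t r)) \<le> norm (U t r) * L" by (rule L)
      also have "\<dots> \<le> (C * 1) * L"
        using u e C L(1) by (intro mult_right_mono order_trans[OF u] mult_left_mono) auto
      finally show ?thesis by simp
    qed
    have bt: "norm (transpose (B r)) \<le> b * L"
      by (rule order_trans[OF L(2) mult_right_mono[OF b]]) (use L(1) in simp)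
    have 1: "norm (U t r ** B r) \<le> C * e * b * K"
      using K(1) C e u b b0
      by (intro order_trans[OF K(2)] mult_right_mono mult_mono) auto
    have 2: "norm (U t r ** B r ** transpose (B r)) \<le> C * e * b * K * (b * L) * K"
      using K(1) C e b0 L(1)
      by (intro order_trans[OF K(2)] mult_right_mono mult_mono 1 bt) auto
    have "norm (cov_fun t r) \<le> C * e * b * K * (b * L) * K * (C * L) * K"
      using K(1) C e b0 L(1)
      by (intro order_trans[OF K(2)] mult_right_mono mult_mono 2 ut) auto
    then show ?thesis by (simp add: D_def e_def mult_ac)
  qed
  moreover have "continuous_on UNIV (cov_fun t)"
    by (intro matrix_cont transpose_cont U_cont B_cont)
  ultimately show ?thesis using \<omega> by (intro exponential_set_integrable)
qed

text \<open>The integral is split at \<open>s\<close>; on the part below \<open>s\<close> the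
  cocycle identity lets \<open>U t s\<close> be taken out.\<close>

lemma drift_int_split:
  assumes "s \<le> t"
  shows "drift_int U f t (-\<infinity>) = drift_int U f t (ereal s) + U t s *v drift_int U f s (-\<infinity>)"
proof -
  have "U t s *v drift_int U f s (-\<infinity>) = (LBINT r=-\<infinity>..ereal s. U t s *v drift_fun s r)"
    unfolding drift_int_def
    by (rule interval_integral_bounded_linear[symmetric])
       (auto intro: matrix_vector_mul_bounded_linear interval_integrable_below drift_set_integrable)
  then show ?thesis
    using interval_integral_below_split[OF drift_set_integrable assms]
    by (simp add: drift_int_def U_mult_vec)
qed

lemma cov_int_split:
  assumes "s \<le> t"
  shows "cov_int U B t (-\<infinity>) = cov_int U B t (ereal s) + U t s ** cov_int U B s (-\<infinity>) ** transpose (U t s)"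
proof -
  have lin: "bounded_linear (\<lambda>X. U t s ** X ** transpose (U t s))"
    by (intro bounded_linear_compose[OF
        bounded_bilinear.bounded_linear_left[OF bounded_bilinear_matrix_mult]
        bounded_bilinear.bounded_linear_right[OF bounded_bilinear_matrix_mult]])
  have "U t s ** cov_int U B s (-\<infinity>) ** transpose (U t s)
      = (LBINT r=-\<infinity>..ereal s. U t s ** cov_fun s r ** transpose (U t s))"
    unfolding cov_int_def
    by (rule interval_integral_bounded_linear[OF lin, symmetric])
       (auto intro: interval_integrable_below cov_set_integrable)
  also have "(\<lambda>r. U t s ** cov_fun s r ** transpose (U t s)) = cov_fun t"
  proof
    fix r
    have "U t s ** cov_fun s r ** transpose (U t s)
        = (U t s ** U s r) ** B r ** transpose (B r) ** transpose (U t s ** U s r)"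
      by (simp only: matrix_transpose_mul matrix_mul_assoc)
    then show "U t s ** cov_fun s r ** transpose (U t s) = cov_fun t r" by (simp only: U_mult)
  qed
  finally show ?thesis
    using interval_integral_below_split[OF cov_set_integrable assms]
    by (simp add: cov_int_def)
qed

text \<open>The integrand is \<open>V ** transpose V\<close> with \<open>V = U t r ** B r\<close>;
  its symmetry and the sign of its quadratic form pass through the integral.\<close>

lemma psd_cov_int:
  assumes "s \<le> ereal t"
  shows "psd (cov_int U B t s)"
  unfolding psd_def
proof (intro conjI allI)
  have int: "interval_lebesgue_integrable lborel s (ereal t) (cov_fun t)"
    by (rule interval_integrable_below[OF cov_set_integrable assms])
  have "transpose (cov_int U B t s) = (LBINT r=s..ereal t. transpose (cov_fun t r))"
    unfolding cov_int_def by (rule interval_integral_bounded_linear[OF bounded_linear_transpose int, symmetric])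
  also have "(\<lambda>r. transpose (cov_fun t r)) = cov_fun t"
    by (simp add: matrix_transpose_mul transpose_transpose matrix_mul_assoc)
  finally show "transpose (cov_int U B t s) = cov_int U B t s" by (simp add: cov_int_def)
  fix h :: "real^'n"
  have lin: "bounded_linear (\<lambda>X. (X *v h) \<bullet> h)"
    by (rule bounded_linear_compose[OF bounded_linear_inner_left
        bounded_bilinear.bounded_linear_left[OF bounded_bilinear_matrix_vector_mult]])
  have "0 \<le> (cov_fun t r *v h) \<bullet> h" for r
  proof -
    define V where "V = U t r ** B r"
    have "cov_fun t r = V ** transpose V"
      by (simp add: V_def matrix_transpose_mul matrix_mul_assoc)
    then have "(cov_fun t r *v h) \<bullet> h = (transpose V *v h) \<bullet> (transpose V *v h)"
      by (simp only: matrix_vector_mul_assoc[symmetric] inner_matrix_vector_mult[of V])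
    then show ?thesis by simp
  qed
  then have "0 \<le> (LBINT r=s..ereal t. (cov_fun t r *v h) \<bullet> h)"
    using assms unfolding interval_lebesgue_integral_def set_lebesgue_integral_def
    by (auto intro!: integral_nonneg_AE)
  also have "\<dots> = (cov_int U B t s *v h) \<bullet> h"
    unfolding cov_int_def by (rule interval_integral_bounded_linear[OF lin int])
  finally show "0 \<le> (cov_int U B t s *v h) \<bullet> h" .
qed

section \<open>Gaussian transition laws and their action on measures\<close>

abbreviation noise :: "real \<Rightarrow> ereal \<Rightarrow> (real^'n) measure" where
  "noise t s \<equiv> gaussian (drift_int U f t s) (cov_int U B t s)"

definition noise_char :: "real \<Rightarrow> ereal \<Rightarrow> real^'n \<Rightarrow> complex" where
  "noise_char t s h = gauss_char (drift_int U f t s) (cov_int U B t s) h"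

lemma borel_prob_noise: "s \<le> ereal t \<Longrightarrow> borel_prob (noise t s)"
  by (intro gaussian_fourier psd_cov_int)

lemma fourier_noise: "s \<le> ereal t \<Longrightarrow> fourier (noise t s) h = noise_char t s h"
  unfolding noise_char_def by (intro gaussian_fourier psd_cov_int)

lemma noise_char_nonzero: "noise_char t s h \<noteq> 0"
  by (simp add: noise_char_def gauss_char_def)

lemma noise_char_split:
  assumes "s \<le> t"
  shows "noise_char t (-\<infinity>) h = noise_char t (ereal s) h * noise_char s (-\<infinity>) (transpose (U t s) *v h)"
  unfolding noise_char_def gauss_char_def drift_int_split[OF assms] cov_int_split[OF assms]
  by (simp add: exp_add[symmetric] matrix_vector_mult_add_rdistrib inner_add_left
      inner_matrix_vector_mult[of "U t s"] matrix_vector_mul_assoc[symmetric] algebra_simps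
      add_divide_distrib)

lemma noise_char_tendsto:
  "(\<lambda>k. noise_char t (ereal (t - real k)) h) \<longlonglongrightarrow> noise_char t (-\<infinity>) h"
  unfolding noise_char_def gauss_char_def drift_int_def cov_int_def
  by (intro tendsto_intros bounded_bilinear.tendsto[OF bounded_bilinear_matrix_vector_mult]
      interval_integral_below_tendsto drift_set_integrable cov_set_integrable) auto

text \<open>The adjoint of the transition operator, acting on measures: the law \<open>M\<close> at
  time \<open>s\<close> is transported by \<open>U t s\<close> and independent Gaussian noise is
  added.\<close>

definition forward :: "real \<Rightarrow> real \<Rightarrow> (real^'n) measure \<Rightarrow> (real^'n) measure" where
  "forward t s M = convolution (noise t (ereal s)) (distr M borel ((*v) (U t s)))"

lemma borel_prob_forward: "s \<le> t \<Longrightarrow> borel_prob M \<Longrightarrow> borel_prob (forward t s M)"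
  unfolding forward_def by (intro borel_prob_convolution borel_prob_noise borel_prob_distr) auto

lemma fourier_forward:
  assumes "s \<le> t" "borel_prob M"
  shows "fourier (forward t s M) h = noise_char t (ereal s) h * fourier M (transpose (U t s) *v h)"
  using assms unfolding forward_def
  by (subst fourier_convolution)
     (auto simp: fourier_noise fourier_distr_matrix intro!: borel_prob_noise borel_prob_distr)

text \<open>Mean and shift can be exchanged: the Gaussian with mean \<open>U t s *v x\<close>
  shifted by the drift equals the noise law shifted by \<open>U t s *v x\<close>. Integrating over
  \<open>x\<close> then produces the convolution.\<close>

lemma integral_transition:
  assumes st: "s \<le> t" and M: "borel_prob M"
    and \<phi>: "continuous_on UNIV \<phi>" "bounded (range \<phi>)"
  shows "(LINT x|M. transition U B f s t \<phi> x) = (LINT x|forward t s M. \<phi> x)"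
proof -
  obtain b where b: "\<And>x. norm (\<phi> x) \<le> b" using \<phi>(2) by (auto simp: bounded_iff)
  have [measurable]: "\<phi> \<in> borel_measurable borel" by (rule borel_measurable_continuous_onI[OF \<phi>(1)])
  have Q: "psd (cov_int U B t (ereal s))" by (intro psd_cov_int) (simp add: st)
  note G = gaussian_fourier(1)[OF Q]
  let ?N = "noise t (ereal s)"
  interpret N: prob_space ?N using G by (simp add: borel_prob_def)
  have [measurable_cong]: "sets ?N = sets borel" using G by (simp add: borel_prob_def)
  have "transition U B f s t \<phi> x = (LINT z|?N. \<phi> (z + U t s *v x))" for x
  proof -
    let ?a = "U t s *v x" and ?g = "drift_int U f t (ereal s)" and ?Q = "cov_int U B t (ereal s)"
    have "distr (gaussian ?a ?Q) borel (\<lambda>y. y + ?g) = distr ?N borel (\<lambda>z. z + ?a)"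
      by (rule fourier_unique)
         (auto simp: fourier_distr_translation G gaussian_fourier[OF Q] gauss_char_def inner_add_left
           exp_add[symmetric] algebra_simps intro!: borel_prob_distr G)
    then have "(LINT y|distr (gaussian ?a ?Q) borel (\<lambda>y. y + ?g). \<phi> y) = (LINT z|distr ?N borel (\<lambda>z. z + ?a). \<phi> z)"
      by simp
    then show ?thesis
      unfolding transition_def
      by (subst (asm) (1 2) integral_distr) (auto simp: borel_prob_measurable[OF G])
  qed
  then have "(LINT x|M. transition U B f s t \<phi> x) = (LINT x|M. LINT z|?N. \<phi> (z + U t s *v x))" by simp
  also have "\<dots> = (LINT y|distr M borel ((*v) (U t s)). LINT z|?N. \<phi> (z + y))"
  proof (rule integral_distr[symmetric])
    show "(*v) (U t s) \<in> measurable M borel" by (simp add: borel_prob_measurable[OF M])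
    show "(\<lambda>y. LINT z|?N. \<phi> (z + y)) \<in> borel_measurable borel" by measurable
  qed
  also have "\<dots> = (LINT x|forward t s M. \<phi> x)"
    unfolding forward_def
    by (rule integral_convolution_bounded[symmetric, OF G _ _ b])
       (auto intro!: borel_prob_distr M)
  finally show ?thesis .
qed

text \<open>Bounded continuous functions separate Borel probability measures, so the integral
  identity becomes an identity of measures.\<close>

lemma evolution_system_iff_forward:
  "evolution_system_of_measures U B f \<nu> \<longleftrightarrow>
    (\<forall>t. borel_prob (\<nu> t)) \<and> (\<forall>s t. s \<le> t \<longrightarrow> \<nu> t = forward t s (\<nu> s))"
proof (intro iffI conjI allI impI)
  fix s t :: real
  assume ev: "evolution_system_of_measures U B f \<nu>" and st: "s \<le> t"
  then have bp: "borel_prob (\<nu> t)" for t by (simp add: evolution_system_of_measures_def)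
  show "\<nu> t = forward t s (\<nu> s)"
    using ev st
    by (intro borel_prob_eqI bp borel_prob_forward)
       (auto simp: evolution_system_of_measures_def integral_transition[OF st bp, symmetric])
next
  assume "(\<forall>t. borel_prob (\<nu> t)) \<and> (\<forall>s t. s \<le> t \<longrightarrow> \<nu> t = forward t s (\<nu> s))"
  then have bp: "\<And>t. borel_prob (\<nu> t)" and fw: "\<And>s t. s \<le> t \<Longrightarrow> forward t s (\<nu> s) = \<nu> t"
    by metis+
  show "evolution_system_of_measures U B f \<nu>"
    unfolding evolution_system_of_measures_def by (auto simp: bp integral_transition fw)
qed (simp add: evolution_system_of_measures_def)

lemma evolution_system_iff_fourier:
  "evolution_system_of_measures U B f \<nu> \<longleftrightarrow>
    (\<forall>t. borel_prob (\<nu> t)) \<and>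
    (\<forall>s t h. s \<le> t \<longrightarrow>
      fourier (\<nu> t) h = noise_char t (ereal s) h * fourier (\<nu> s) (transpose (U t s) *v h))"
proof -
  have "\<nu> t = forward t s (\<nu> s) \<longleftrightarrow>
      (\<forall>h. fourier (\<nu> t) h = noise_char t (ereal s) h * fourier (\<nu> s) (transpose (U t s) *v h))"
    if "s \<le> t" "\<And>t. borel_prob (\<nu> t)" for s t
    using that fourier_unique[OF that(2) borel_prob_forward[OF that]] fourier_forward[OF that]
    by metis
  then show ?thesis unfolding evolution_system_iff_forward by blast
qed

section \<open>The correspondence with families given by Fourier transforms\<close>

lemma ex1_fourier_family:
  assumes \<mu>: "borel_prob \<mu>"
  shows "\<exists>!m. fourier_family U t0 \<mu> m"
proof (rule ex1I)
  \<comment> \<open>The images of \<open>\<mu>\<close> under \<open>U t t0\<close> have the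
    prescribed transforms, which leave no other choice.\<close>
  show "fourier_family U t0 \<mu> (\<lambda>t. distr \<mu> borel ((*v) (U t t0)))"
    by (auto simp: fourier_family_def fourier_distr_matrix \<mu> intro!: borel_prob_distr)
  then show "m = (\<lambda>t. distr \<mu> borel ((*v) (U t t0)))" if "fourier_family U t0 \<mu> m" for m
    using that by (auto simp: fourier_family_def intro!: ext fourier_unique)
qed

lemma evolution_system_of_fourier_family:
  assumes m: "fourier_family U t0 \<mu> m"
  shows "evolution_system_of_measures U B f (\<lambda>t. convolution (noise t (-\<infinity>)) (m t))"
  unfolding evolution_system_iff_fourier
proof (intro conjI allI impI)
  have bm: "borel_prob (m t)" and fm: "fourier (m t) h = fourier \<mu> (transpose (U t t0) *v h)" for t h
    using m by (auto simp: fourier_family_def)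
  show "borel_prob (convolution (noise t (-\<infinity>)) (m t))" for t
    by (intro borel_prob_convolution borel_prob_noise bm) simp
  show "fourier (convolution (noise t (-\<infinity>)) (m t)) h = noise_char t (ereal s) h *
      fourier (convolution (noise s (-\<infinity>)) (m s)) (transpose (U t s) *v h)" if "s \<le> t" for s t h
    by (simp add: fourier_convolution borel_prob_noise bm fourier_noise fm U_transpose_mult_vec
        noise_char_split[OF that] del: transpose_matrix_vector)
qed

lemma ex_fourier_family_of_evolution_system:
  assumes ev: "evolution_system_of_measures U B f \<nu>"
  shows "\<exists>\<mu> m. borel_prob \<mu> \<and> fourier_family U t0 \<mu> m \<and>
    (\<forall>t. \<nu> t = convolution (noise t (-\<infinity>)) (m t))"
proof -
  have bp: "\<And>t. borel_prob (\<nu> t)" and fw: "\<And>s t h. s \<le> t \<Longrightarrow>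
      fourier (\<nu> t) h = noise_char t (ereal s) h * fourier (\<nu> s) (transpose (U t s) *v h)"
    using ev unfolding evolution_system_iff_fourier by auto
  define \<sigma> where "\<sigma> k = distr (\<nu> (t0 - real k)) borel ((*v) (U t0 (t0 - real k)))" for k
  define \<psi> where "\<psi> h = fourier (\<nu> t0) h / noise_char t0 (-\<infinity>) h" for h
  have "\<exists>\<mu>. borel_prob \<mu> \<and> (\<forall>h. fourier \<mu> h = \<psi> h)"
  proof (rule fourier_levy_continuity)
    show "borel_prob (\<sigma> k)" for k unfolding \<sigma>_def by (intro borel_prob_distr bp) simp
    \<comment> \<open>The evolution identity from \<open>t0 - real k\<close> to \<open>t0\<close> is
      solved for the image measure, since Gaussian transforms never vanish.\<close>
    have "fourier (\<sigma> k) h = fourier (\<nu> t0) h / noise_char t0 (ereal (t0 - real k)) h" for k h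
      using fw[of "t0 - real k" t0 h]
      by (simp add: \<sigma>_def fourier_distr_matrix bp noise_char_nonzero)
    then show "(\<lambda>k. fourier (\<sigma> k) h) \<longlonglongrightarrow> \<psi> h" for h
      unfolding \<psi>_def by (simp add: tendsto_divide noise_char_tendsto noise_char_nonzero)
    have "continuous_on UNIV (fourier (noise t0 (-\<infinity>)))"
      by (intro continuous_on_fourier borel_prob_noise) simp
    then have "continuous_on UNIV (noise_char t0 (-\<infinity>))"
      by (simp add: fourier_noise cong: continuous_on_cong)
    then have "continuous_on UNIV \<psi>"
      unfolding \<psi>_def using noise_char_nonzero
      by (intro continuous_on_divide continuous_on_fourier bp) auto
    then show "isCont \<psi> 0" by (simp add: continuous_on_eq_continuous_at)
  qed
  then obtain \<mu> where \<mu>: "borel_prob \<mu>" and f\<mu>: "\<And>h. fourier \<mu> h = \<psi> h" by blast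
  obtain m where m: "fourier_family U t0 \<mu> m" using ex1_fourier_family[OF \<mu>] by blast
  have bm: "borel_prob (m t)" and fm: "fourier (m t) h = \<psi> (transpose (U t t0) *v h)" for t h
    using m f\<mu> by (auto simp: fourier_family_def)
  have "fourier (\<nu> t) h = noise_char t (-\<infinity>) h * \<psi> (transpose (U t t0) *v h)" for t h
  proof (cases "t0 \<le> t")
    case True
    then show ?thesis
      using fw[OF True, of h] noise_char_split[OF True, of h]
      by (simp add: \<psi>_def noise_char_nonzero)
  next
    case False
    then have le: "t \<le> t0" by simp
    \<comment> \<open>Going back in time uses invertibility: \<open>transpose (U t0 t)\<close>
      recovers \<open>h\<close> from \<open>k\<close>, so the forward identity from \<open>t\<close>
      to \<open>t0\<close> at \<open>k\<close> determines
      \<open>fourier (\<nu> t) h\<close>.\<close>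
    define k where "k = transpose (U t t0) *v h"
    have "transpose (U t0 t) *v k = h"
      by (simp add: k_def U_transpose_mult_vec U_id transpose_mat del: transpose_matrix_vector)
    then show ?thesis
      using fw[OF le, of k] noise_char_split[OF le, of k]
      by (simp add: \<psi>_def noise_char_nonzero k_def[symmetric] field_simps del: transpose_matrix_vector)
  qed
  then have "\<nu> t = convolution (noise t (-\<infinity>)) (m t)" for t
    by (intro fourier_unique bp borel_prob_convolution borel_prob_noise bm)
       (simp_all add: fourier_convolution borel_prob_noise bm fourier_noise fm)
  then show ?thesis using \<mu> m by blast
qed

end

theorem proposition2p2:
  fixes A B :: "real \<Rightarrow> real^'n^'n"
    and f :: "real \<Rightarrow> real^'n"
    and U :: "real \<Rightarrow> real \<Rightarrow> real^'n^'n"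
    and mu0 t0 :: real
  assumes "continuous_on UNIV A" and "bounded (range A)"
    and "continuous_on UNIV B" and "bounded (range B)"
    and "continuous_on UNIV f" and "bounded (range f)"
    and "mu0 > 0" and "\<And>t x. norm (B t *v x) \<ge> mu0 * norm x"
    and "evolution_family A U"
    and "growth_bound U < 0"
  shows "(\<forall>\<mu>. borel_prob \<mu> \<longrightarrow>
            (\<exists>!m. fourier_family U t0 \<mu> m) \<and>
            (\<forall>m. fourier_family U t0 \<mu> m \<longrightarrow>
               evolution_system_of_measures U B f
                 (\<lambda>t. convolution (gaussian (drift_int U f t (-\<infinity>)) (cov_int U B t (-\<infinity>))) (m t)))) \<and>
         (\<forall>\<nu>. evolution_system_of_measures U B f \<nu> \<longrightarrow>
            (\<exists>\<mu> m. borel_prob \<mu> \<and> fourier_family U t0 \<mu> m \<and>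
               (\<forall>t. \<nu> t =
                  convolution (gaussian (drift_int U f t (-\<infinity>)) (cov_int U B t (-\<infinity>))) (m t))))"
proof -
  obtain C \<omega> where C: "C > 0" "\<omega> < 0" "\<And>s t. s \<le> t \<Longrightarrow> norm (U t s) \<le> C * exp (\<omega> * (t - s))"
    using growth_bound_neg[OF assms(10)] by blast
  note cocycle = evolution_family_cocycle[OF assms(9,2)]
  interpret ornstein_uhlenbeck U B f C \<omega>
  proof
    show "U s s = mat 1" for s using assms(9) by (simp add: evolution_family_def)
    show "continuous_on UNIV (U t)" for t
      using evolution_family_continuous_right[OF assms(9) cocycle C(3,2,1)] .
  qed (use assms C cocycle in auto)
  show ?thesis
    using ex1_fourier_family evolution_system_of_fourier_family
      ex_fourier_family_of_evolution_system by blast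
qed

end
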